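(* Let $\Omega$ be a Polish space, let $\Theta\subset\mathcal{M}_1(\Omega)$ be weakly compact, and let $\mathbb{E}=\sup_{P\in\Theta}E_P$ be the associated sublinear expectation. Let $\{\xi_k\}_{k\ge1}\subset L^{1+\beta}_{\mathbb{E}}(\Omega)$, $\beta>0$, be a sequence of independent and identically distributed (i.i.d.) random variables under $\mathbb{E}$. Set $\underline{\mu}=-\mathbb{E}[-\xi_1]$, $\overline{\mu}=\mathbb{E}[\xi_1]$ and $\bar{\xi}_n=\frac{\xi_1+\cdots+\xi_n}{n}$. Then, for any $\mu\in[\underline{\mu},\overline{\mu}]$, there exists $P_\mu\in\Theta$ such that $$E_{P_\mu}[\xi_n]=\kappa_n(\mu)\quad\text{for all } n\ge1.$$ In particular, $$\lim_{n\to\infty}\bar{\xi}_n=\mu,\quad P_\mu\text{-a.s.}$$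
   Context: $\mathcal{M}_1(\Omega)$ is the set of Borel probability measures on $\Omega$ and $C_b(\Omega)$ the bounded continuous functions. For $p\ge1$, $L^p_{\mathbb{E}}(\Omega)$ is the completion of $C_b(\Omega)$ under the norm $\|\xi\|_p=(\mathbb{E}[|\xi|^p])^{1/p}$, where $\mathbb{E}[\xi]=\sup_{P\in\Theta}E_P[\xi]$; its elements are identified with Borel functions $X$ for which there are $X_n\in C_b(\Omega)$ with $\sup_{P\in\Theta}E_P[|X-X_n|^p]\to0$ (modulo sets null under every $P\in\Theta$), and $\mathbb{E}[X]=\sup_{P\in\Theta}E_P[X]$ for such $X$. The numbers $\kappa_n(\mu)$, $n\ge1$, are defined for $\mu\in[\underline{\mu},\overline{\mu}]$ recursively: $\kappa_1(\mu)=\overline{\mu}$ if $\mu\ge\frac{\overline{\mu}+\underline{\mu}}{2}$ and $\kappa_1(\mu)=\underline{\mu}$ if $\mu<\frac{\overline{\mu}+\underline{\mu}}{2}$; and, with $\mu_n=(\kappa_1(\mu)+\cdots+\kappa_n(\mu))/n$, $\kappa_{n+1}(\mu)=\overline{\mu}$ if $\mu\ge\mu_n$ and $\kappa_{n+1}(\mu)=\underline{\mu}$ if $\mu<\mu_n$. $C_{b,Lip}(\mathbb{R}^n)$ denotes the bounded Lipschitz functions on $\mathbb{R}^n$. A random vector $\mathbf{X}$ ($m$-dimensional) is independent of $\mathbf{Y}$ ($n$-dimensional) under $\mathbb{E}$ if for any $\varphi\in C_{b,Lip}(\mathbb{R}^{n+m})$, $\mathbb{E}[\varphi(\mathbf{Y},\mathbf{X})]=\mathbb{E}\big[\mathbb{E}[\varphi(\mathbf{y},\mathbf{X})]|_{\mathbf{y}=\mathbf{Y}}\big]$.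 $\mathbf{X}\overset{d}{=}\mathbf{Y}$ means $\mathbb{E}[\varphi(\mathbf{X})]=\mathbb{E}[\varphi(\mathbf{Y})]$ for every bounded Lipschitz $\varphi$. A sequence $(X_i)_{i\ge1}$ is i.i.d. if, for each $i\ge1$, $X_{i+1}$ is independent of $(X_1,\dots,X_i)$ and $X_{i+1}\overset{d}{=}X_i$. *)

theory Defs
  imports "HOL-Probability.Probability"
begin

text \<open>
  The set of Borel probability measures is \<open>space (prob_algebra borel)\<close>. The weak topology on it
  is the coarsest one making \<open>P \<mapsto> E\<^sub>P f\<close> continuous for every bounded continuous \<open>f\<close>.
\<close>

definition weak_topology :: "'a::polish_space measure topology" where
  "weak_topology = topology_generated_by
     {{P \<in> space (prob_algebra borel). (\<integral>\<omega>. f \<omega> \<partial>P) \<in> U} | (f :: 'a \<Rightarrow> real) U.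
        f \<in> bcontfun \<and> open U}"

text \<open>
  A supremum in \<^typ>\<open>real\<close>: it is the intended one for nonempty \<open>\<Theta>\<close> and those \<open>X\<close> that
  are integrable under every \<open>P \<in> \<Theta>\<close> with bounded expectations, in particular for all
  members of \<open>L_space \<Theta> p\<close> below with \<open>p \<ge> 1\<close>.
\<close>

definition sublin_expectation :: "'a measure set \<Rightarrow> ('a \<Rightarrow> real) \<Rightarrow> real" where
  "sublin_expectation \<Theta> X = (SUP P\<in>\<Theta>. \<integral>\<omega>. X \<omega> \<partial>P)"

text \<open>
  The elements of the completion of the bounded continuous functions, represented by Borel
  functions (not by equivalence classes). The supremum is taken in \<^typ>\<open>ennreal\<close>, so that
  non-integrable differences count as infinite.
\<close>

definition L_space :: "'a::polish_space measure set \<Rightarrow> real \<Rightarrow> ('a \<Rightarrow> real) set" where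
  "L_space \<Theta> p = {X \<in> borel_measurable borel. \<exists>Xn :: nat \<Rightarrow> 'a \<Rightarrow> real.
     (\<forall>n. Xn n \<in> bcontfun) \<and>
     (\<lambda>n. SUP P\<in>\<Theta>. \<integral>\<^sup>+\<omega>. ennreal (\<bar>X \<omega> - Xn n \<omega>\<bar> powr p) \<partial>P) \<longlonglongrightarrow> 0}"

text \<open>
  Points of \<open>\<real>\<^sup>n\<close> are real lists of length \<open>n\<close>, so that \<open>(y, x)\<close> is \<open>y @ x\<close>; the values of
  a test function on lists of other lengths are irrelevant.
\<close>

definition Cb_Lip :: "nat \<Rightarrow> (real list \<Rightarrow> real) set" where
  "Cb_Lip n = {\<phi>. bounded (\<phi> ` {x. length x = n}) \<and>
     (\<exists>L. \<forall>x y. length x = n \<longrightarrow> length y = n \<longrightarrow>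
        \<bar>\<phi> x - \<phi> y\<bar> \<le> L * L2_set (\<lambda>i. x ! i - y ! i) {..<n})}"

text \<open>The \<open>m\<close>-dimensional \<open>X\<close> is independent of the \<open>n\<close>-dimensional \<open>Y\<close> (in this order).\<close>

definition indep_of ::
  "'a measure set \<Rightarrow> nat \<Rightarrow> ('a \<Rightarrow> real list) \<Rightarrow> nat \<Rightarrow> ('a \<Rightarrow> real list) \<Rightarrow> bool" where
  "indep_of \<Theta> m X n Y \<longleftrightarrow> (\<forall>\<phi>\<in>Cb_Lip (n + m).
     sublin_expectation \<Theta> (\<lambda>\<omega>. \<phi> (Y \<omega> @ X \<omega>)) =
     sublin_expectation \<Theta> (\<lambda>\<omega>. sublin_expectation \<Theta> (\<lambda>\<omega>'. \<phi> (Y \<omega> @ X \<omega>'))))"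

definition ident_distr ::
  "'a measure set \<Rightarrow> nat \<Rightarrow> ('a \<Rightarrow> real list) \<Rightarrow> ('a \<Rightarrow> real list) \<Rightarrow> bool" where
  "ident_distr \<Theta> m X Y \<longleftrightarrow> (\<forall>\<phi>\<in>Cb_Lip m.
     sublin_expectation \<Theta> (\<lambda>\<omega>. \<phi> (X \<omega>)) = sublin_expectation \<Theta> (\<lambda>\<omega>. \<phi> (Y \<omega>)))"

text \<open>Sequences are indexed from 1; the member with index 0 is ignored.\<close>

definition iid_seq :: "'a measure set \<Rightarrow> (nat \<Rightarrow> 'a \<Rightarrow> real) \<Rightarrow> bool" where
  "iid_seq \<Theta> \<xi> \<longleftrightarrow> (\<forall>i\<ge>1.
     indep_of \<Theta> 1 (\<lambda>\<omega>. [\<xi> (Suc i) \<omega>]) i (\<lambda>\<omega>. map (\<lambda>k. \<xi> k \<omega>) [1..<Suc i]) \<and>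
     ident_distr \<Theta> 1 (\<lambda>\<omega>. [\<xi> (Suc i) \<omega>]) (\<lambda>\<omega>. [\<xi> i \<omega>]))"

text \<open>\<open>lo\<close> and \<open>hi\<close> are the lower and upper means; the value at index 0 is irrelevant.\<close>

function kappa :: "real \<Rightarrow> real \<Rightarrow> real \<Rightarrow> nat \<Rightarrow> real" where
  "kappa lo hi \<mu> 0 = 0"
| "kappa lo hi \<mu> (Suc 0) = (if \<mu> \<ge> (hi + lo) / 2 then hi else lo)"
| "kappa lo hi \<mu> (Suc (Suc n)) =
     (if \<mu> \<ge> (\<Sum>k=1..Suc n. kappa lo hi \<mu> k) / real (Suc n) then hi else lo)"
  by pat_completeness auto
termination
  by (relation "Wellfounded.measure (\<lambda>(lo, hi, \<mu>, n). n)") auto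

end

theory Submission
  imports Defs
begin

text \<open>
  Write \<open>M\<^sub>c\<close> for the sublinear expectation of \<open>c * \<xi> 1\<close>, which every \<open>c * \<xi> k\<close> shares. Every value
  \<open>kappa lo hi \<mu> k\<close> is one of the two extreme means, so prescribing it is the same as asking for
  \<open>E\<^sub>P[c\<^sub>k \<xi>\<^sub>k] = M\<^sub>c\<^sub>k\<close> with a sign \<open>c\<^sub>k\<close>: the prescribed mean is an extremal one.
  
  Independence makes the sublinear expectation additive on \<open>c\<^sub>1 \<xi>\<^sub>1 + \<dots> + c\<^sub>n \<xi>\<^sub>n\<close>, and every summand has
  \<open>E\<^sub>P[c\<^sub>k \<xi>\<^sub>k] \<le> M\<^sub>c\<^sub>k\<close> under every \<open>P\<close>. A measure that nearly maximises the sum therefore nearly maximises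
  all summands at once (\<open>exists_near_optimal\<close>). Expectations of members of \<open>L_space\<close> are weakly
  continuous on \<open>\<Theta>\<close>, so compactness turns these nearly optimal measures into a single \<open>P\<close> that
  is exactly optimal for all \<open>k\<close> (\<open>exists_optimal\<close>).
  
  For the almost sure limit, let \<open>\<psi> \<ge> 0\<close> be a test function of \<open>\<xi>\<^sub>1, \<dots>, \<xi>\<^sub>n\<close>. Conditioning on the past
  inside the sublinear expectation gives \<open>E\<^sub>P[\<psi> (c \<xi>\<^sub>n\<^sub>+\<^sub>1 - M\<^sub>c)] \<le> 0\<close>. At an optimal \<open>P\<close> there is
  equality for \<open>\<psi> = 1\<close>; taking \<open>\<psi> = 1 + f\<close> and \<open>\<psi> = 1 - f\<close> with \<open>\<bar>f\<bar> \<le> 1\<close> yields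
  equality for \<open>f\<close> as well. So under \<open>P\<close> the centred variables are martingale differences, tested
  against functions of their partial sums (\<open>martingale_difference\<close>).
  
  Martingale differences with bounded \<open>p\<close>-th moments, \<open>1 < p \<le> 2\<close>, obey the strong law
  (\<open>martingale_difference_slln\<close>). The function \<open>G(x) = sqrt (1 + x\<^sup>2)\<close> has a bounded Lipschitz
  derivative and a second-order remainder of size \<open>\<bar>b\<bar> powr p\<close>, so \<open>E[G(S\<^sub>n / n)] - 1 = O(n powr (1 - p))\<close>.
  That is summable along a polynomial subsequence, whose gaps are short enough to be controlled by
  moments alone.
  
  Finally, the greedy rule that defines \<open>kappa\<close> keeps its partial sums within \<open>hi - lo\<close> of \<open>n * \<mu>\<close>,
  so the averages of the means tend to \<open>\<mu>\<close>.
\<close>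

section \<open>Power inequalities and the function sqrt (1 + x^2)\<close>

lemma square_le_powr:
  fixes t p :: real
  assumes "0 \<le> t" "t \<le> 1" "p \<le> 2"
  shows "t\<^sup>2 \<le> t powr p"
proof (cases "t = 0")
  case False
  then have "t\<^sup>2 = t powr 2" using assms by (simp add: powr_numeral)
  also have "\<dots> \<le> t powr p" using False assms by (intro powr_mono') auto
  finally show ?thesis .
qed simp

lemma powr_le_of_le_add:
  fixes u v b p :: real
  assumes "0 \<le> u" "u \<le> v + b" "0 \<le> p"
  shows "u powr p \<le> 2 powr p * (v powr p + b powr p)"
proof -
  have "u \<le> 2 * max v b" using assms(2) by (simp add: max_def)
  then have "u powr p \<le> (2 * max v b) powr p" using assms by (intro powr_mono2)
  also have "\<dots> = 2 powr p * (max v b) powr p" by (rule powr_mult)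
  also have "\<dots> \<le> 2 powr p * (v powr p + b powr p)"
    by (intro mult_left_mono) (auto simp: max_def)
  finally show ?thesis .
qed

text \<open>
  This inequality trades a first moment for a \<open>p\<close>-th moment: below the level \<open>\<theta>\<close> the first term
  dominates, above it the second one. The level is chosen to suit each application.
\<close>

lemma abs_le_weighted_powr:
  fixes x \<theta> p :: real
  assumes "0 < \<theta>" "1 \<le> p"
  shows "\<bar>x\<bar> \<le> \<theta> + \<theta> powr (1 - p) * \<bar>x\<bar> powr p"
proof (cases "\<bar>x\<bar> \<le> \<theta>")
  case True
  then show ?thesis by (smt (verit) mult_nonneg_nonneg powr_ge_zero)
next
  case False
  have "\<bar>x\<bar> = \<bar>x\<bar> powr (1 - p) * \<bar>x\<bar> powr p"
    using False assms by (simp flip: powr_add)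
  also have "\<dots> \<le> \<theta> powr (1 - p) * \<bar>x\<bar> powr p"
    using False assms by (intro mult_right_mono powr_mono2') auto
  finally show ?thesis using assms by simp
qed

lemma sqrt_one_plus_square_diff_le:
  fixes x y :: real
  shows "\<bar>sqrt (1 + x\<^sup>2) - sqrt (1 + y\<^sup>2)\<bar> \<le> \<bar>x - y\<bar>"
proof -
  let ?u = "sqrt (1 + x\<^sup>2)" and ?v = "sqrt (1 + y\<^sup>2)"
  have uv: "?u > 0" "?v > 0" "?u\<^sup>2 = 1 + x\<^sup>2" "?v\<^sup>2 = 1 + y\<^sup>2"
    by (auto simp: add_pos_nonneg)
  have "\<bar>x\<bar> \<le> ?u" "\<bar>y\<bar> \<le> ?v"
    by (auto intro!: real_le_rsqrt)
  then have le: "\<bar>x + y\<bar> \<le> ?u + ?v" by linarith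
  have "(?u - ?v) * (?u + ?v) = (x - y) * (x + y)"
    using uv(3,4) by (simp add: algebra_simps power2_eq_square)
  then have "\<bar>?u - ?v\<bar> * (?u + ?v) = \<bar>x - y\<bar> * \<bar>x + y\<bar>"
    using uv by (metis abs_mult abs_of_pos add_pos_pos)
  also have "\<dots> \<le> \<bar>x - y\<bar> * (?u + ?v)" using le by (intro mult_left_mono) auto
  finally show ?thesis using uv by simp
qed

text \<open>
  The derivative of \<open>sqrt (1 + x\<^sup>2)\<close>.
\<close>

definition hyp_slope :: "real \<Rightarrow> real" where
  "hyp_slope x = x / sqrt (1 + x\<^sup>2)"

lemma abs_hyp_slope_le_1: "\<bar>hyp_slope x\<bar> \<le> 1"
proof -
  have "\<bar>x\<bar> \<le> sqrt (1 + x\<^sup>2)" by (rule real_le_rsqrt) auto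
  then show ?thesis unfolding hyp_slope_def by (simp add: abs_divide divide_le_eq_1 add_pos_nonneg)
qed

lemma hyp_slope_lipschitz: "\<bar>hyp_slope x - hyp_slope y\<bar> \<le> 2 * \<bar>x - y\<bar>"
proof -
  let ?u = "sqrt (1 + x\<^sup>2)" and ?v = "sqrt (1 + y\<^sup>2)"
  have uv: "?u \<ge> 1" "?v \<ge> 1" by auto
  have nz: "?u \<noteq> 0" "?v \<noteq> 0" using uv by linarith+
  have "hyp_slope x - hyp_slope y = (x - y) / ?u + hyp_slope y * (?v - ?u) / ?u"
    unfolding hyp_slope_def using nz by (simp add: field_simps)
  also have "\<bar>\<dots>\<bar> \<le> \<bar>x - y\<bar> / ?u + \<bar>hyp_slope y\<bar> * \<bar>?v - ?u\<bar> / ?u"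
    using uv by (intro order_trans[OF abs_triangle_ineq]) (simp add: abs_mult abs_divide)
  also have "\<dots> \<le> \<bar>x - y\<bar> / 1 + 1 * \<bar>x - y\<bar> / 1"
    using uv sqrt_one_plus_square_diff_le[of y x] abs_hyp_slope_le_1[of y]
    by (intro add_mono frac_le mult_mono) (auto simp: abs_minus_commute)
  finally show ?thesis by simp
qed

lemma borel_measurable_hyp_slope [measurable]: "hyp_slope \<in> borel_measurable borel"
  unfolding hyp_slope_def by measurable

text \<open>
  First-order Taylor expansion of \<open>sqrt (1 + x\<^sup>2)\<close>. Its remainder is at most \<open>b\<^sup>2\<close> (linearise the square root)
  and at most \<open>2 * \<bar>b\<bar>\<close> because the function is 1-Lipschitz; the smaller of the two is bounded by
  \<open>2 * \<bar>b\<bar> powr p\<close> for every exponent between 1 and 2.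
\<close>

lemma sqrt_one_plus_square_step:
  fixes a b p :: real
  assumes "1 \<le> p" "p \<le> 2"
  shows "sqrt (1 + (a + b)\<^sup>2) \<le> sqrt (1 + a\<^sup>2) + hyp_slope a * b + 2 * \<bar>b\<bar> powr p"
proof -
  let ?u = "sqrt (1 + a\<^sup>2)" and ?v = "sqrt (1 + (a + b)\<^sup>2)"
  have u: "?u \<ge> 1" "?u\<^sup>2 = 1 + a\<^sup>2" "?v\<^sup>2 = 1 + (a + b)\<^sup>2" by auto
  \<comment> \<open>The arithmetic-geometric mean inequality linearises the square root \<open>?v\<close> around \<open>?u\<close>.\<close>
  have quad: "?v \<le> ?u + hyp_slope a * b + b\<^sup>2"
  proof -
    have "2 * ?u * ?v \<le> ?u\<^sup>2 + ?v\<^sup>2" by (rule sum_squares_bound)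
    also have "\<dots> = 2 * ?u\<^sup>2 + 2 * (a * b) + b\<^sup>2"
      using u by (simp add: power2_eq_square algebra_simps)
    finally have "?v \<le> (2 * ?u\<^sup>2 + 2 * (a * b) + b\<^sup>2) / (2 * ?u)"
      using u(1) by (subst pos_le_divide_eq) (linarith, simp only: mult_ac)
    also have "\<dots> = ?u + hyp_slope a * b + b\<^sup>2 / (2 * ?u)"
    proof -
      have "(2 * w\<^sup>2 + 2 * (a * b) + b\<^sup>2) / (2 * w) = w + a / w * b + b\<^sup>2 / (2 * w)"
        if "1 \<le> w" for w :: real
        using that by (simp add: field_simps power2_eq_square)
      then show ?thesis using u(1) unfolding hyp_slope_def by blast
    qed
    also have "b\<^sup>2 / (2 * ?u) \<le> b\<^sup>2 / 1"
    proof (rule frac_le)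
      show "1 \<le> 2 * ?u" using u(1) by linarith
    qed auto
    finally show ?thesis by simp
  qed
  have lin: "?v \<le> ?u + hyp_slope a * b + 2 * \<bar>b\<bar>"
  proof -
    have "?v - ?u \<le> \<bar>b\<bar>" using sqrt_one_plus_square_diff_le[of "a + b" a] by simp
    moreover have "\<bar>hyp_slope a * b\<bar> \<le> 1 * \<bar>b\<bar>"
      unfolding abs_mult by (intro mult_right_mono abs_hyp_slope_le_1) auto
    ultimately show ?thesis by linarith
  qed
  show ?thesis
  proof (cases "\<bar>b\<bar> \<le> 1")
    case True
    then have "b\<^sup>2 \<le> \<bar>b\<bar> powr p" using square_le_powr[of "\<bar>b\<bar>" p] assms by simp
    then show ?thesis using quad by (smt (verit) powr_ge_zero)
  next
    case False
    have "\<bar>b\<bar> powr 1 \<le> \<bar>b\<bar> powr p" using False assms by (intro powr_mono) auto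
    then show ?thesis using lin by simp
  qed
qed

section \<open>A strong law for martingale differences\<close>

text \<open>
  By monotone convergence the series of the \<open>f j\<close> has a finite integral, hence converges almost surely.
\<close>

lemma AE_tendsto_0_of_summable_integral:
  fixes f :: "nat \<Rightarrow> 'a \<Rightarrow> real" and b :: "nat \<Rightarrow> real"
  assumes [measurable]: "\<And>j. f j \<in> borel_measurable M"
    and nonneg: "\<And>j x. 0 \<le> f j x"
    and bound: "\<And>j. (\<integral>\<^sup>+x. ennreal (f j x) \<partial>M) \<le> ennreal (b j)"
    and b: "\<And>j. 0 \<le> b j" "summable b"
  shows "AE x in M. (\<lambda>j. f j x) \<longlonglongrightarrow> 0"
proof -
  have "(\<integral>\<^sup>+x. (\<Sum>j. ennreal (f j x)) \<partial>M) = (\<Sum>j. \<integral>\<^sup>+x. ennreal (f j x) \<partial>M)"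
    by (rule nn_integral_suminf) measurable
  also have "\<dots> \<le> (\<Sum>j. ennreal (b j))"
    by (intro suminf_le bound) auto
  also have "\<dots> = ennreal (\<Sum>j. b j)"
    using b by (intro suminf_ennreal2) auto
  also have "\<dots> < \<infinity>" by simp
  finally have "AE x in M. (\<Sum>j. ennreal (f j x)) \<noteq> \<infinity>"
    by (intro nn_integral_PInf_AE) auto
  then show ?thesis
  proof eventually_elim
    case (elim x)
    then have "summable (\<lambda>j. f j x)"
      by (intro summable_suminf_not_top nonneg) (auto simp: nonneg)
    then show ?case by (rule summable_LIMSEQ_zero)
  qed
qed

text \<open>
  Along the subsequence \<open>(j + 1) ^ r\<close> the relative gap between consecutive terms is of order \<open>1 / (j + 1)\<close>.
\<close>

lemma polynomial_gap_bound:
  fixes j r :: nat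
  assumes "1 \<le> r"
  shows "(real (j + 2)) ^ r - real (Suc j) ^ r \<le> real r * 2 ^ r * real (Suc j) ^ r / real (Suc j)"
proof -
  let ?x = "real (Suc j)" and ?y = "real (j + 2)"
  have y: "?y = ?x + 1" "?y \<le> 2 * ?x" "?x > 0" by auto
  have "?y ^ r - ?x ^ r = (?y - ?x) * (\<Sum>i<r. ?x ^ (r - Suc i) * ?y ^ i)"
    by (rule power_diff_sumr2)
  also have "\<dots> = (\<Sum>i<r. ?x ^ (r - Suc i) * ?y ^ i)" using y by simp
  also have "\<dots> \<le> (\<Sum>i<r. 2 ^ r * (?x ^ r / ?x))"
  proof (rule sum_mono)
    fix i assume i: "i \<in> {..<r}"
    have "?x ^ (r - Suc i) * ?y ^ i \<le> ?x ^ (r - Suc i) * (2 * ?x) ^ i"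
      using y by (intro mult_left_mono power_mono) auto
    also have "\<dots> = 2 ^ i * (?x ^ (r - Suc i) * ?x ^ i)"
      by (simp only: power_mult_distrib mult_ac)
    also have "?x ^ (r - Suc i) * ?x ^ i = ?x ^ (r - 1)"
      by (subst power_add[symmetric]) (use i in simp)
    also have "2 ^ i * ?x ^ (r - 1) \<le> 2 ^ r * ?x ^ (r - 1)"
      using i by (intro mult_right_mono power_increasing) auto
    also have "?x ^ (r - 1) = ?x ^ r / ?x" using assms y by (simp add: power_diff)
    finally show "?x ^ (r - Suc i) * ?y ^ i \<le> 2 ^ r * (?x ^ r / ?x)" by simp
  qed
  also have "\<dots> = real r * 2 ^ r * ?x ^ r / ?x" by simp
  finally show ?thesis .
qed

lemma tendsto_0_between_subsequence:
  fixes s :: "nat \<Rightarrow> real" and D :: "nat \<Rightarrow> real" and m :: "nat \<Rightarrow> nat"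
  assumes m: "strict_mono m" "\<And>j. 0 < m j"
    and gap: "\<And>j n. m j \<le> n \<Longrightarrow> n < m (Suc j) \<Longrightarrow> \<bar>s n - s (m j)\<bar> \<le> D j"
    and sub: "(\<lambda>j. s (m j) / real (m j)) \<longlonglongrightarrow> 0"
    and D: "(\<lambda>j. D j / real (m j)) \<longlonglongrightarrow> 0"
  shows "(\<lambda>n. s n / real n) \<longlonglongrightarrow> 0"
proof (rule LIMSEQ_I)
  fix e :: real assume "0 < e"
  have D0: "0 \<le> D j" for j
    using gap[of j "m j"] m(1) by (smt (verit) lessI order_refl strict_mono_less)
  from \<open>0 < e\<close> sub have "\<forall>\<^sub>F j in sequentially. \<bar>s (m j) / real (m j)\<bar> < e / 2"
    using tendstoD[OF sub, of "e/2"] by (simp add: dist_real_def)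
  moreover from \<open>0 < e\<close> D have "\<forall>\<^sub>F j in sequentially. \<bar>D j / real (m j)\<bar> < e / 2"
    using tendstoD[OF D, of "e/2"] by (simp add: dist_real_def)
  ultimately have "\<forall>\<^sub>F j in sequentially. \<bar>s (m j)\<bar> / real (m j) + D j / real (m j) < e"
    proof eventually_elim
    case (elim j)
    have "\<bar>s (m j)\<bar> / real (m j) < e / 2" "D j / real (m j) < e / 2"
      using elim D0[of j] m(2)[of j] by (simp_all only: abs_divide abs_of_nonneg of_nat_0_le_iff)
    then show ?case by linarith
  qed
  then obtain J where J: "\<And>j. j \<ge> J \<Longrightarrow> \<bar>s (m j)\<bar> / real (m j) + D j / real (m j) < e"
    by (auto simp: eventually_sequentially)
  show "\<exists>no. \<forall>n\<ge>no. norm (s n / real n - 0) < e"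
  proof (intro exI allI impI)
    fix n assume n: "m J \<le> n"
    have unb: "n < m (Suc n)"
      using strict_mono_imp_increasing[OF m(1), of "Suc n"] by simp
    define k where "k = (LEAST k. n < m k)"
    have k: "n < m k" unfolding k_def using unb by (rule LeastI)
    have "J < k" using k n m(1) by (metis leI le_less_trans less_le_not_le strict_mono_less_eq)
    then obtain j where kj: "k = Suc j" "J \<le> j" by (cases k) auto
    have j: "m j \<le> n" using kj not_less_Least[of j "\<lambda>k. n < m k"] unfolding k_def by simp
    have "\<bar>s n\<bar> \<le> \<bar>s (m j)\<bar> + D j" using gap[of j n] j k kj by auto
    then have "\<bar>s n\<bar> / real n \<le> (\<bar>s (m j)\<bar> + D j) / real (m j)"
      using j m(2)[of j] D0[of j] by (intro frac_le) auto
    also have "\<dots> < e" using J[OF kj(2)] by (simp add: add_divide_distrib)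
    finally show "norm (s n / real n - 0) < e" by (simp add: abs_divide)
  qed
qed


text \<open>
  Each step of the Taylor expansion contributes a first-order term, whose expectation vanishes because
  \<open>hyp_slope\<close> is an admissible test function, and a remainder of expectation at most
  \<open>2 * K * \<sigma> powr (- p)\<close>. It is a substitute for the von Bahr-Esseen inequality that uses
  only bounded Lipschitz functions of the partial sums.
\<close>

lemma (in prob_space) expected_hyperbola_bound:
  fixes d :: "nat \<Rightarrow> 'a \<Rightarrow> real" and K p \<sigma> :: real
  assumes p: "1 < p" "p \<le> 2" and K: "0 \<le> K" and \<sigma>: "0 < \<sigma>"
    and [measurable]: "\<And>i. d i \<in> borel_measurable M"
    and moment: "\<And>i. (\<integral>\<^sup>+x. ennreal (\<bar>d i x\<bar> powr p) \<partial>M) \<le> ennreal K"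
    and mart: "\<And>n f L. (\<And>t. \<bar>f t\<bar> \<le> 1) \<Longrightarrow> (\<And>s t. \<bar>f s - f t\<bar> \<le> L * \<bar>s - t\<bar>) \<Longrightarrow>
      (\<integral>x. f (\<Sum>i<n. d i x) * d n x \<partial>M) = 0"
  shows "(\<integral>\<^sup>+x. ennreal (sqrt (1 + ((\<Sum>i<n. d i x) / \<sigma>)\<^sup>2) - 1) \<partial>M)
    \<le> ennreal (2 * real n * K * \<sigma> powr (- p))"
proof -
  define S where "S n x = (\<Sum>i<n. d i x)" for n x
  have [measurable]: "S n \<in> borel_measurable M" for n unfolding S_def by measurable
  have ip: "integrable M (\<lambda>x. \<bar>d i x\<bar> powr p)" for i
    using moment[of i] by (intro integrableI_bounded) (auto intro: le_less_trans)
  have Ep: "expectation (\<lambda>x. \<bar>d i x\<bar> powr p) \<le> K" for i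
    using moment[of i] ip[of i] K by (subst (asm) nn_integral_eq_integral) auto
  have id: "integrable M (d i)" for i
  proof (rule Bochner_Integration.integrable_bound)
    show "integrable M (\<lambda>x. 1 + 1 powr (1 - p) * \<bar>d i x\<bar> powr p)" using ip by simp
    show "AE x in M. norm (d i x) \<le> norm (1 + 1 powr (1 - p) * \<bar>d i x\<bar> powr p)"
      using abs_le_weighted_powr[of 1 p] p by (intro AE_I2) (simp add: add_nonneg_nonneg)
  qed measurable
  have iS: "integrable M (\<lambda>x. sqrt (1 + (S n x / \<sigma>)\<^sup>2))" for n
  proof (rule Bochner_Integration.integrable_bound)
    show "integrable M (\<lambda>x. 1 + \<bar>S n x / \<sigma>\<bar>)" unfolding S_def using id by simp
    show "AE x in M. norm (sqrt (1 + (S n x / \<sigma>)\<^sup>2)) \<le> norm (1 + \<bar>S n x / \<sigma>\<bar>)"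
      using sqrt_one_plus_square_diff_le[of _ 0] by (intro AE_I2) (smt (verit) real_norm_def
       power_zero_numeral real_sqrt_one real_sqrt_ge_zero zero_le_power2)
  qed measurable
  have step: "expectation (\<lambda>x. sqrt (1 + (S n x / \<sigma>)\<^sup>2)) \<le> 1 + 2 * real n * K * \<sigma> powr (- p)" for n
  proof (induction n)
    case 0
    show ?case by (simp add: S_def prob_space)
  next
    case (Suc n)
    have i1: "integrable M (\<lambda>x. hyp_slope (S n x / \<sigma>) * (d n x / \<sigma>))"
    proof (rule Bochner_Integration.integrable_bound)
      show "integrable M (\<lambda>x. d n x / \<sigma>)" using id by simp
      show "AE x in M. norm (hyp_slope (S n x / \<sigma>) * (d n x / \<sigma>)) \<le> norm (d n x / \<sigma>)"
        by (intro AE_I2)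
          (metis abs_ge_zero abs_mult abs_hyp_slope_le_1 mult_left_le_one_le real_norm_def)
    qed measurable
    have i2: "integrable M (\<lambda>x. 2 * \<bar>d n x / \<sigma>\<bar> powr p)"
      using ip[of n] \<sigma> by (simp add: abs_divide powr_divide)
    have "expectation (\<lambda>x. sqrt (1 + (S (Suc n) x / \<sigma>)\<^sup>2)) \<le>
      expectation (\<lambda>x. sqrt (1 + (S n x / \<sigma>)\<^sup>2) + hyp_slope (S n x / \<sigma>) * (d n x / \<sigma>)
        + 2 * \<bar>d n x / \<sigma>\<bar> powr p)"
    proof (rule integral_mono)
      fix x
      show "sqrt (1 + (S (Suc n) x / \<sigma>)\<^sup>2) \<le> sqrt (1 + (S n x / \<sigma>)\<^sup>2)
          + hyp_slope (S n x / \<sigma>) * (d n x / \<sigma>) + 2 * \<bar>d n x / \<sigma>\<bar> powr p"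
        using sqrt_one_plus_square_step[of p "S n x / \<sigma>" "d n x / \<sigma>"] p
        by (simp add: S_def add_divide_distrib)
    qed (use iS i1 i2 in auto)
    also have "\<dots> = expectation (\<lambda>x. sqrt (1 + (S n x / \<sigma>)\<^sup>2))
        + expectation (\<lambda>x. hyp_slope (S n x / \<sigma>) * (d n x / \<sigma>))
        + expectation (\<lambda>x. 2 * \<bar>d n x / \<sigma>\<bar> powr p)"
      using iS i1 i2 by simp
    also have "expectation (\<lambda>x. hyp_slope (S n x / \<sigma>) * (d n x / \<sigma>)) = 0"
    proof -
      have "expectation (\<lambda>x. hyp_slope (S n x / \<sigma>) * d n x) = 0"
        unfolding S_def
      proof (rule mart[of "\<lambda>s. hyp_slope (s / \<sigma>)" "2 / \<sigma>"])
        show "\<bar>hyp_slope (s / \<sigma>) - hyp_slope (t / \<sigma>)\<bar> \<le> 2 / \<sigma> * \<bar>s - t\<bar>" for s t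
          using hyp_slope_lipschitz[of "s / \<sigma>" "t / \<sigma>"] \<sigma>
          by (simp add: abs_divide flip: diff_divide_distrib)
      qed (rule abs_hyp_slope_le_1)
      then show ?thesis by simp
    qed
    also have "expectation (\<lambda>x. 2 * \<bar>d n x / \<sigma>\<bar> powr p) \<le> 2 * (K * \<sigma> powr (- p))"
      using Ep[of n] \<sigma> by (simp add: abs_divide powr_divide powr_minus_divide divide_right_mono)
    finally show ?case using Suc.IH by (simp add: algebra_simps)
  qed
  have "(\<integral>\<^sup>+x. ennreal (sqrt (1 + (S n x / \<sigma>)\<^sup>2) - 1) \<partial>M)
      = ennreal (expectation (\<lambda>x. sqrt (1 + (S n x / \<sigma>)\<^sup>2) - 1))"
    using iS by (intro nn_integral_eq_integral) auto
  also have "\<dots> \<le> ennreal (2 * real n * K * \<sigma> powr (- p))"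
    using step[of n] iS by (intro ennreal_leI) (simp add: prob_space)
  finally show ?thesis unfolding S_def .
qed

text \<open>
  The martingale property is required only in the weak form in which independence under a sublinear
  expectation delivers it: \<open>d n\<close> is orthogonal to bounded Lipschitz functions of the preceding partial sum.
\<close>

lemma (in prob_space) martingale_difference_slln:
  fixes d :: "nat \<Rightarrow> 'a \<Rightarrow> real" and K p :: real
  assumes p: "1 < p" "p \<le> 2" and K: "0 \<le> K"
    and [measurable]: "\<And>i. d i \<in> borel_measurable M"
    and moment: "\<And>i. (\<integral>\<^sup>+x. ennreal (\<bar>d i x\<bar> powr p) \<partial>M) \<le> ennreal K"
    and mart: "\<And>n f L. (\<And>t. \<bar>f t\<bar> \<le> 1) \<Longrightarrow> (\<And>s t. \<bar>f s - f t\<bar> \<le> L * \<bar>s - t\<bar>) \<Longrightarrow>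
      (\<integral>x. f (\<Sum>i<n. d i x) * d n x \<partial>M) = 0"
  shows "AE x in M. (\<lambda>n. (\<Sum>i<n. d i x) / real n) \<longlonglongrightarrow> 0"
proof -
  define S where "S n x = (\<Sum>i<n. d i x)" for n x
  have [measurable]: "S n \<in> borel_measurable M" for n unfolding S_def by measurable
  \<comment> \<open>The subsequence \<open>m j\<close> grows so fast that \<open>m j powr (1 - p) \<le> (j + 1) powr (- 2)\<close>, which is summable.\<close>
  obtain r0 :: nat where "2 / (p - 1) \<le> real r0" using real_arch_simple by blast
  then have "2 \<le> real r0 * (p - 1)" using p by (simp add: field_simps)
  moreover have "real r0 * (p - 1) \<le> real (Suc r0) * (p - 1)" using p by (intro mult_right_mono) auto
  ultimately obtain r :: nat where r: "2 \<le> real r * (p - 1)" "1 \<le> r"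
    by (metis le_add1 order_trans plus_1_eq_Suc)
  define m where "m j = (Suc j) ^ r" for j
  have m_mono: "strict_mono m"
    unfolding m_def strict_mono_Suc_iff using r by (auto intro!: power_strict_mono)
  have m_pos: "0 < m j" for j unfolding m_def by simp
  have m_real: "real (m j) = real (Suc j) powr real r" for j
    unfolding m_def by (simp add: powr_realpow)

  have "AE x in M. (\<lambda>j. sqrt (1 + (S (m j) x / real (m j))\<^sup>2) - 1) \<longlonglongrightarrow> 0"
  proof (rule AE_tendsto_0_of_summable_integral)
    fix j
    have "(\<integral>\<^sup>+x. ennreal (sqrt (1 + (S (m j) x / real (m j))\<^sup>2) - 1) \<partial>M)
        \<le> ennreal (2 * real (m j) * K * real (m j) powr (- p))"
      unfolding S_def using p K m_pos
      by (intro expected_hyperbola_bound[OF _ _ _ _ _ moment mart]) auto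
    also have "\<dots> \<le> ennreal (2 * K * real (Suc j) powr (- 2))"
    proof (rule ennreal_leI)
      have "real (m j) * real (m j) powr (- p) = real (m j) powr (1 - p)"
        using m_pos[of j] by (simp add: powr_add[of _ 1 "-p", simplified])
      also have "\<dots> = real (Suc j) powr (real r * (1 - p))"
        unfolding m_real by (rule powr_powr)
      also have "\<dots> \<le> real (Suc j) powr (- 2)"
        using r by (intro powr_mono) (auto simp: algebra_simps)
      finally have "2 * K * (real (m j) * real (m j) powr (- p)) \<le> 2 * K * real (Suc j) powr (- 2)"
        using K by (intro mult_left_mono) auto
      then show "2 * real (m j) * K * real (m j) powr (- p) \<le> 2 * K * real (Suc j) powr (- 2)"
        by (simp only: mult_ac)
    qed
    finally show "(\<integral>\<^sup>+x. ennreal (sqrt (1 + (S (m j) x / real (m j))\<^sup>2) - 1) \<partial>M)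
        \<le> ennreal (2 * K * real (Suc j) powr (- 2))" .
  next
    have "summable (\<lambda>j. real j powr (- 2))" by (subst summable_real_powr_iff) simp
    then have "summable (\<lambda>j. real (Suc j) powr (- 2))" by (subst summable_Suc_iff)
    then show "summable (\<lambda>j. 2 * K * real (Suc j) powr (- 2))" by (rule summable_mult)
  qed (use K in auto)
  then have sub: "AE x in M. (\<lambda>j. S (m j) x / real (m j)) \<longlonglongrightarrow> 0"
  proof eventually_elim
    case (elim x)
    let ?y = "\<lambda>j. S (m j) x / real (m j)"
    have "(\<lambda>j. ((sqrt (1 + (?y j)\<^sup>2) - 1) + 1)\<^sup>2 - 1) \<longlonglongrightarrow> (0 + 1)\<^sup>2 - 1"
      by (intro tendsto_intros elim)
    then have "(\<lambda>j. (?y j)\<^sup>2) \<longlonglongrightarrow> 0" by (simp add: add_nonneg_nonneg)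
    then have "(\<lambda>j. sqrt ((?y j)\<^sup>2)) \<longlonglongrightarrow> sqrt 0" by (intro tendsto_intros)
    then show ?case by (simp only: real_sqrt_abs tendsto_rabs_zero_iff real_sqrt_zero)
  qed

  text \<open>
    Between two terms of the subsequence, \<open>abs_le_weighted_powr\<close> with level \<open>\<theta> j\<close> bounds the increments.
    The part below the level contributes \<open>\<theta> j / (j + 1)\<close> after division by \<open>m j\<close>, which tends to 0;
    the part above it is \<open>W j\<close>, whose integral is of the summable order \<open>\<theta> j powr (1 - p) / (j + 1)\<close>.
    Any power of \<open>j + 1\<close> with exponent strictly between 0 and 1 would do as the level.
  \<close>
  define \<theta> where "\<theta> j = sqrt (real (Suc j))" for j
  define W where "W j x = \<theta> j powr (1 - p) * (\<Sum>i=m j..<m (Suc j). \<bar>d i x\<bar> powr p) / real (m j)" for j x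
  define C where "C = real r * 2 ^ r"
  have C0: "0 \<le> C" unfolding C_def by simp
  have gapC: "real (m (Suc j) - m j) / real (m j) \<le> C / real (Suc j)" for j
  proof -
    have "real (m (Suc j) - m j) = real (j + 2) ^ r - real (Suc j) ^ r"
      using m_mono by (simp add: of_nat_diff strict_mono_less_eq) (simp add: m_def)
    also have "\<dots> \<le> C * real (m j) / real (Suc j)"
      using polynomial_gap_bound[OF r(2), of j] by (simp add: C_def m_def)
    finally show ?thesis using m_pos[of j] by (simp add: field_simps)
  qed
  have \<theta>_ge_1: "1 \<le> \<theta> j" for j unfolding \<theta>_def by simp
  have \<theta>_div: "\<theta> j / real (Suc j) = real (Suc j) powr (- (1 / 2))" for j
  proof -
    have "\<theta> j / real (Suc j) = real (Suc j) powr (1 / 2) / real (Suc j) powr 1"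
      unfolding \<theta>_def by (simp add: powr_half_sqrt)
    also have "\<dots> = real (Suc j) powr (1 / 2 - 1)" by (rule powr_diff[symmetric])
    finally show ?thesis by simp
  qed
  have "AE x in M. (\<lambda>j. W j x) \<longlonglongrightarrow> 0"
  proof (rule AE_tendsto_0_of_summable_integral)
    show "W j \<in> borel_measurable M" for j unfolding W_def by measurable
    show "0 \<le> W j x" for j x unfolding W_def by (simp add: sum_nonneg)
    fix j
    let ?c = "\<theta> j powr (1 - p) / real (m j)" and ?I = "{m j..<m (Suc j)}"
    have c: "0 \<le> ?c" by simp
    have "(\<integral>\<^sup>+x. ennreal (W j x) \<partial>M) = (\<integral>\<^sup>+x. ennreal ?c * (\<Sum>i\<in>?I. ennreal (\<bar>d i x\<bar> powr p)) \<partial>M)"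
      using c by (intro nn_integral_cong) (simp add: W_def sum_nonneg flip: ennreal_mult)
    also have "\<dots> = ennreal ?c * (\<Sum>i\<in>?I. \<integral>\<^sup>+x. ennreal (\<bar>d i x\<bar> powr p) \<partial>M)"
      by (simp add: nn_integral_cmult nn_integral_sum del: sum_ennreal)
    also have "\<dots> \<le> ennreal ?c * (\<Sum>i\<in>?I. ennreal K)"
      by (intro mult_left_mono sum_mono moment) auto
    also have "\<dots> = ennreal (\<theta> j powr (1 - p) * K * (real (m (Suc j) - m j) / real (m j)))"
      using K by (simp add: ennreal_of_nat_eq_real_of_nat mult_ac flip: ennreal_mult)
    also have "\<dots> \<le> ennreal (\<theta> j powr (1 - p) * K * (C / real (Suc j)))"
      using K gapC by (intro ennreal_leI mult_left_mono) auto
    also have "\<theta> j powr (1 - p) * K * (C / real (Suc j)) = K * C * real (Suc j) powr (- (1 + p) / 2)"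
    proof -
      have "\<theta> j powr (1 - p) / real (Suc j) = real (Suc j) powr ((1 - p) / 2) * real (Suc j) powr (- 1)"
        unfolding \<theta>_def by (simp add: powr_half_sqrt[symmetric] powr_powr powr_minus_divide)
      also have "\<dots> = real (Suc j) powr (- (1 + p) / 2)"
      proof -
        have "(1 - p) / 2 + - 1 = - (1 + p) / 2" by (simp add: field_simps)
        then show ?thesis by (metis powr_add)
      qed
      finally have eq: "\<theta> j powr (1 - p) / real (Suc j) = real (Suc j) powr (- (1 + p) / 2)" .
      have "\<theta> j powr (1 - p) * K * (C / real (Suc j)) = K * C * (\<theta> j powr (1 - p) / real (Suc j))"
        by simp
      then show ?thesis unfolding eq .
    qed
    finally show "(\<integral>\<^sup>+x. ennreal (W j x) \<partial>M) \<le> ennreal (K * C * real (Suc j) powr (- (1 + p) / 2))" .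
    show "0 \<le> K * C * real (Suc j) powr (- (1 + p) / 2)" using K C0 by simp
  next
    have "summable (\<lambda>j. real j powr (- (1 + p) / 2))" using p by (subst summable_real_powr_iff) simp
    then have "summable (\<lambda>j. real (Suc j) powr (- (1 + p) / 2))" by (subst summable_Suc_iff)
    then show "summable (\<lambda>j. K * C * real (Suc j) powr (- (1 + p) / 2))" by (rule summable_mult)
  qed
  moreover have "(\<lambda>j. C * real (Suc j) powr (- (1 / 2))) \<longlonglongrightarrow> C * 0"
    by (intro tendsto_mult tendsto_const tendsto_neg_powr filterlim_compose[OF filterlim_real_sequentially filterlim_Suc]) auto
  ultimately have bl: "AE x in M. (\<lambda>j. C * real (Suc j) powr (- (1 / 2)) + W j x) \<longlonglongrightarrow> 0"
    by (auto elim!: eventually_mono dest: tendsto_add)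
  show ?thesis
    using sub bl
  proof eventually_elim
    case (elim x)
    have "(\<lambda>n. S n x / real n) \<longlonglongrightarrow> 0"
    proof (rule tendsto_0_between_subsequence[OF m_mono m_pos])
      let ?D = "\<lambda>j. real (m j) * (C * real (Suc j) powr (- (1 / 2)) + W j x)"
      show "(\<lambda>j. ?D j / real (m j)) \<longlonglongrightarrow> 0" using elim(2) m_pos by (simp add: less_imp_neq[THEN not_sym])
      fix j n assume n: "m j \<le> n" "n < m (Suc j)"
      have "{..<n} = {..<m j} \<union> {m j..<n}" using n by auto
      then have "S n x - S (m j) x = (\<Sum>i=m j..<n. d i x)"
        unfolding S_def by (simp add: sum.union_disjoint ivl_disj_int)
      also have "\<bar>\<dots>\<bar> \<le> (\<Sum>i=m j..<n. \<bar>d i x\<bar>)" by (rule sum_abs)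
      also have "\<dots> \<le> (\<Sum>i=m j..<m (Suc j). \<bar>d i x\<bar>)" using n by (intro sum_mono2) auto
      also have "\<dots> \<le> (\<Sum>i=m j..<m (Suc j). \<theta> j + \<theta> j powr (1 - p) * \<bar>d i x\<bar> powr p)"
        using \<theta>_ge_1[of j] p by (intro sum_mono abs_le_weighted_powr) auto
      also have "\<dots> = real (m (Suc j) - m j) * \<theta> j + real (m j) * W j x"
        using m_pos[of j] by (simp add: sum.distrib W_def flip: sum_distrib_left)
      also have "real (m (Suc j) - m j) * \<theta> j \<le> real (m j) * (C / real (Suc j)) * \<theta> j"
        using gapC[of j] m_pos[of j] \<theta>_ge_1[of j] by (intro mult_right_mono) (auto simp: field_simps)
      also have "\<dots> = real (m j) * (C * (\<theta> j / real (Suc j)))" by simp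
      finally show "\<bar>S n x - S (m j) x\<bar> \<le> ?D j" unfolding \<theta>_div by (simp add: distrib_left)
    qed (use elim in auto)
    then show ?case unfolding S_def .
  qed
qed

section \<open>Test functions\<close>

definition bounded_lipschitz :: "(real \<Rightarrow> real) \<Rightarrow> bool" where
  "bounded_lipschitz f \<longleftrightarrow> (\<exists>B. \<forall>t. \<bar>f t\<bar> \<le> B) \<and> (\<exists>L. \<forall>s t. \<bar>f s - f t\<bar> \<le> L * \<bar>s - t\<bar>)"

lemma bounded_lipschitz_measurable:
  assumes "bounded_lipschitz f"
  shows "f \<in> borel_measurable borel"
proof -
  obtain L where L: "\<bar>f s - f t\<bar> \<le> L * \<bar>s - t\<bar>" for s t
    using assms unfolding bounded_lipschitz_def by blast
  have "(max L 0)-lipschitz_on UNIV f"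
    unfolding lipschitz_on_def dist_real_def
    using L by (auto intro: order_trans[OF _ mult_right_mono[of L "max L 0"]])
  then have "continuous_on UNIV f" by (rule lipschitz_on_continuous_on)
  then show ?thesis by (rule borel_measurable_continuous_onI)
qed

lemma Cb_LipI:
  assumes "\<And>x. length x = n \<Longrightarrow> \<bar>\<phi> x\<bar> \<le> B"
    and "\<And>x y. length x = n \<Longrightarrow> length y = n \<Longrightarrow> \<bar>\<phi> x - \<phi> y\<bar> \<le> L * L2_set (\<lambda>i. x ! i - y ! i) {..<n}"
  shows "\<phi> \<in> Cb_Lip n"
  unfolding Cb_Lip_def using assms by (auto intro!: boundedI[where B = B])

lemma Cb_LipE:
  assumes "\<phi> \<in> Cb_Lip n"
  obtains B L where "0 \<le> B" "0 \<le> L" "\<And>x. length x = n \<Longrightarrow> \<bar>\<phi> x\<bar> \<le> B"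
    "\<And>x y. length x = n \<Longrightarrow> length y = n \<Longrightarrow> \<bar>\<phi> x - \<phi> y\<bar> \<le> L * L2_set (\<lambda>i. x ! i - y ! i) {..<n}"
proof -
  obtain B where B: "\<And>x. length x = n \<Longrightarrow> \<bar>\<phi> x\<bar> \<le> B"
    using assms unfolding Cb_Lip_def bounded_iff by auto
  obtain L where L: "\<And>x y. length x = n \<Longrightarrow> length y = n \<Longrightarrow>
      \<bar>\<phi> x - \<phi> y\<bar> \<le> L * L2_set (\<lambda>i. x ! i - y ! i) {..<n}"
    using assms unfolding Cb_Lip_def by auto
  show thesis
  proof (rule that[of "max B 0" "max L 0"])
    fix x y :: "real list" assume "length x = n" "length y = n"
    then have "\<bar>\<phi> x - \<phi> y\<bar> \<le> L * L2_set (\<lambda>i. x ! i - y ! i) {..<n}" by (rule L)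
    also have "\<dots> \<le> max L 0 * L2_set (\<lambda>i. x ! i - y ! i) {..<n}"
      by (intro mult_right_mono) auto
    finally show "\<bar>\<phi> x - \<phi> y\<bar> \<le> max L 0 * L2_set (\<lambda>i. x ! i - y ! i) {..<n}" .
  qed (use B in \<open>auto simp: le_max_iff_disj\<close>)
qed

text \<open>
  The function \<open>g\<close> may be unbounded, as coordinates and their sums are.
\<close>

lemma Cb_Lip_compose:
  assumes "bounded_lipschitz f"
    and g: "\<And>x y. length x = n \<Longrightarrow> length y = n \<Longrightarrow> \<bar>g x - g y\<bar> \<le> C * L2_set (\<lambda>i. x ! i - y ! i) {..<n}"
  shows "(\<lambda>x. f (g x)) \<in> Cb_Lip n"
proof -
  obtain B L where BL: "\<And>t. \<bar>f t\<bar> \<le> B" "\<And>s t. \<bar>f s - f t\<bar> \<le> L * \<bar>s - t\<bar>"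
    using assms(1) unfolding bounded_lipschitz_def by blast
  show ?thesis
  proof (rule Cb_LipI)
    fix x y :: "real list" assume xy: "length x = n" "length y = n"
    have "\<bar>f (g x) - f (g y)\<bar> \<le> L * \<bar>g x - g y\<bar>" by (rule BL)
    also have "\<dots> \<le> \<bar>L\<bar> * \<bar>g x - g y\<bar>" by (intro mult_right_mono) auto
    also have "\<dots> \<le> \<bar>L\<bar> * (C * L2_set (\<lambda>i. x ! i - y ! i) {..<n})"
      using xy by (intro mult_left_mono g) auto
    finally show "\<bar>f (g x) - f (g y)\<bar> \<le> (\<bar>L\<bar> * C) * L2_set (\<lambda>i. x ! i - y ! i) {..<n}"
      by (simp add: mult.assoc)
  qed (rule BL)
qed

lemma Cb_Lip_nth:
  assumes "bounded_lipschitz f" "i < n"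
  shows "(\<lambda>x. f (x ! i)) \<in> Cb_Lip n"
proof (rule Cb_Lip_compose[OF assms(1)])
  show "\<bar>x ! i - y ! i\<bar> \<le> 1 * L2_set (\<lambda>i. x ! i - y ! i) {..<n}" for x y :: "real list"
    using member_le_L2_set[of "{..<n}" i "\<lambda>i. \<bar>x ! i - y ! i\<bar>"] assms(2)
    by (simp add: L2_set_def)
qed

lemma Cb_Lip_sum_coordinates:
  assumes "bounded_lipschitz f"
  shows "(\<lambda>x. f (\<Sum>i<n. x ! i)) \<in> Cb_Lip n"
proof (rule Cb_Lip_compose[OF assms])
  fix x y :: "real list"
  have "\<bar>(\<Sum>i<n. x ! i) - (\<Sum>i<n. y ! i)\<bar> \<le> (\<Sum>i<n. \<bar>x ! i - y ! i\<bar>)"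
    unfolding sum_subtractf[symmetric] by (rule sum_abs)
  also have "\<dots> \<le> (\<Sum>i<n. L2_set (\<lambda>i. x ! i - y ! i) {..<n})"
  proof (rule sum_mono)
    fix i assume "i \<in> {..<n}"
    then show "\<bar>x ! i - y ! i\<bar> \<le> L2_set (\<lambda>i. x ! i - y ! i) {..<n}"
      using member_le_L2_set[of "{..<n}" i "\<lambda>i. \<bar>x ! i - y ! i\<bar>"]
      by (simp add: L2_set_def)
  qed
  finally show "\<bar>(\<Sum>i<n. x ! i) - (\<Sum>i<n. y ! i)\<bar> \<le> real n * L2_set (\<lambda>i. x ! i - y ! i) {..<n}"
    by simp
qed

lemma Cb_Lip_const: "(\<lambda>x. c) \<in> Cb_Lip n"
  by (rule Cb_LipI[where B = "\<bar>c\<bar>" and L = 0]) auto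

lemma Cb_Lip_add:
  assumes "\<phi> \<in> Cb_Lip n" "\<psi> \<in> Cb_Lip n"
  shows "(\<lambda>x. \<phi> x + \<psi> x) \<in> Cb_Lip n"
proof -
  obtain B L where 1: "0 \<le> B" "0 \<le> L" "\<And>x. length x = n \<Longrightarrow> \<bar>\<phi> x\<bar> \<le> B"
    "\<And>x y. length x = n \<Longrightarrow> length y = n \<Longrightarrow> \<bar>\<phi> x - \<phi> y\<bar> \<le> L * L2_set (\<lambda>i. x ! i - y ! i) {..<n}"
    using assms(1) by (rule Cb_LipE) (blast intro: that)
  obtain B' L' where 2: "0 \<le> B'" "0 \<le> L'" "\<And>x. length x = n \<Longrightarrow> \<bar>\<psi> x\<bar> \<le> B'"
    "\<And>x y. length x = n \<Longrightarrow> length y = n \<Longrightarrow> \<bar>\<psi> x - \<psi> y\<bar> \<le> L' * L2_set (\<lambda>i. x ! i - y ! i) {..<n}"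
    using assms(2) by (rule Cb_LipE) (blast intro: that)
  show ?thesis
  proof (rule Cb_LipI[where B = "B + B'" and L = "L + L'"])
    fix x y :: "real list" assume xy: "length x = n" "length y = n"
    show "\<bar>\<phi> x + \<psi> x\<bar> \<le> B + B'" using 1(3)[OF xy(1)] 2(3)[OF xy(1)] by linarith
    show "\<bar>\<phi> x + \<psi> x - (\<phi> y + \<psi> y)\<bar> \<le> (L + L') * L2_set (\<lambda>i. x ! i - y ! i) {..<n}"
      unfolding distrib_right using 1(4)[OF xy] 2(4)[OF xy] by linarith
  qed
qed

lemma Cb_Lip_mult:
  assumes "\<phi> \<in> Cb_Lip n" "\<psi> \<in> Cb_Lip n"
  shows "(\<lambda>x. \<phi> x * \<psi> x) \<in> Cb_Lip n"
proof -
  obtain B L where 1: "0 \<le> B" "0 \<le> L" "\<And>x. length x = n \<Longrightarrow> \<bar>\<phi> x\<bar> \<le> B"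
    "\<And>x y. length x = n \<Longrightarrow> length y = n \<Longrightarrow> \<bar>\<phi> x - \<phi> y\<bar> \<le> L * L2_set (\<lambda>i. x ! i - y ! i) {..<n}"
    using assms(1) by (rule Cb_LipE) (blast intro: that)
  obtain B' L' where 2: "0 \<le> B'" "0 \<le> L'" "\<And>x. length x = n \<Longrightarrow> \<bar>\<psi> x\<bar> \<le> B'"
    "\<And>x y. length x = n \<Longrightarrow> length y = n \<Longrightarrow> \<bar>\<psi> x - \<psi> y\<bar> \<le> L' * L2_set (\<lambda>i. x ! i - y ! i) {..<n}"
    using assms(2) by (rule Cb_LipE) (blast intro: that)
  show ?thesis
  proof (rule Cb_LipI[where B = "B * B'" and L = "B * L' + B' * L"])
    fix x y :: "real list" assume xy: "length x = n" "length y = n"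
    let ?n = "L2_set (\<lambda>i. x ! i - y ! i) {..<n}"
    show "\<bar>\<phi> x * \<psi> x\<bar> \<le> B * B'"
      unfolding abs_mult using 1 2 xy by (intro mult_mono) auto
    have "\<phi> x * \<psi> x - \<phi> y * \<psi> y = \<phi> x * (\<psi> x - \<psi> y) + \<psi> y * (\<phi> x - \<phi> y)"
      by (simp add: algebra_simps)
    also have "\<bar>\<dots>\<bar> \<le> \<bar>\<phi> x\<bar> * \<bar>\<psi> x - \<psi> y\<bar> + \<bar>\<psi> y\<bar> * \<bar>\<phi> x - \<phi> y\<bar>"
      by (rule order_trans[OF abs_triangle_ineq]) (simp add: abs_mult)
    also have "\<dots> \<le> B * (L' * ?n) + B' * (L * ?n)"
      using 1 2 xy by (intro add_mono mult_mono) auto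
    finally show "\<bar>\<phi> x * \<psi> x - \<phi> y * \<psi> y\<bar> \<le> (B * L' + B' * L) * ?n"
      by (simp add: algebra_simps)
  qed
qed

lemma Cb_Lip_sum:
  assumes "\<And>i. i \<in> I \<Longrightarrow> \<phi> i \<in> Cb_Lip n"
  shows "(\<lambda>x. \<Sum>i\<in>I. \<phi> i x) \<in> Cb_Lip n"
  using assms
proof (induction I rule: infinite_finite_induct)
  case (insert i I)
  then show ?case by (simp add: Cb_Lip_add)
qed (simp_all add: Cb_Lip_const)

lemma Cb_Lip_take:
  assumes "\<phi> \<in> Cb_Lip n"
  shows "(\<lambda>x. \<phi> (take n x)) \<in> Cb_Lip (n + m)"
proof -
  obtain B L where 1: "0 \<le> B" "0 \<le> L" "\<And>x. length x = n \<Longrightarrow> \<bar>\<phi> x\<bar> \<le> B"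
    "\<And>x y. length x = n \<Longrightarrow> length y = n \<Longrightarrow> \<bar>\<phi> x - \<phi> y\<bar> \<le> L * L2_set (\<lambda>i. x ! i - y ! i) {..<n}"
    using assms by (rule Cb_LipE) (blast intro: that)
  show ?thesis
  proof (rule Cb_LipI)
    fix x y :: "real list" assume xy: "length x = n + m" "length y = n + m"
    show "\<bar>\<phi> (take n x)\<bar> \<le> B" using xy by (intro 1) auto
    have "\<bar>\<phi> (take n x) - \<phi> (take n y)\<bar> \<le> L * L2_set (\<lambda>i. take n x ! i - take n y ! i) {..<n}"
      using xy by (intro 1) auto
    also have "L2_set (\<lambda>i. take n x ! i - take n y ! i) {..<n} = L2_set (\<lambda>i. x ! i - y ! i) {..<n}"
      by (simp add: L2_set_def)
    also have "L * \<dots> \<le> L * L2_set (\<lambda>i. x ! i - y ! i) {..<n + m}"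
      unfolding L2_set_def using 1(2)
      by (intro mult_left_mono real_sqrt_le_mono sum_mono2) auto
    finally show "\<bar>\<phi> (take n x) - \<phi> (take n y)\<bar> \<le> L * L2_set (\<lambda>i. x ! i - y ! i) {..<n + m}" .
  qed
qed

text \<open>
  The test functions in the definition of independence are bounded, so each \<open>\<xi> k\<close> enters through its
  truncation at a level \<open>N\<close>, which is sent to infinity afterwards.
\<close>

definition clip :: "real \<Rightarrow> real \<Rightarrow> real" where
  "clip N x = max (- N) (min N x)"

lemma abs_clip_le: "0 \<le> N \<Longrightarrow> \<bar>clip N x\<bar> \<le> N"
  unfolding clip_def by linarith

lemma bounded_lipschitz_cmult_clip:
  assumes "0 \<le> N"
  shows "bounded_lipschitz (\<lambda>x. c * clip N x)"
  unfolding bounded_lipschitz_def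
proof (intro conjI exI allI)
  show "\<bar>c * clip N t\<bar> \<le> \<bar>c\<bar> * N" for t
    unfolding abs_mult by (intro mult_left_mono abs_clip_le assms) auto
  show "\<bar>c * clip N s - c * clip N t\<bar> \<le> \<bar>c\<bar> * \<bar>s - t\<bar>" for s t
    unfolding right_diff_distrib[symmetric] abs_mult
    by (intro mult_left_mono) (auto simp: clip_def)
qed

lemma borel_measurable_clip [measurable]: "clip N \<in> borel_measurable borel"
  unfolding clip_def by measurable

lemma clip_error:
  assumes "0 < N" "1 \<le> p"
  shows "\<bar>x - clip N x\<bar> \<le> N powr (1 - p) * \<bar>x\<bar> powr p"
proof (cases "\<bar>x\<bar> \<le> N")
  case True
  then show ?thesis by (auto simp: clip_def)
next
  case False
  then have "\<bar>x - clip N x\<bar> = \<bar>x\<bar> - N" using assms by (auto simp: clip_def)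
  then show ?thesis using abs_le_weighted_powr[OF assms, of x] by linarith
qed

text \<open>
  A bounded Lipschitz approximation of \<open>\<bar>x\<bar> powr p\<close> from below; it carries the moment bound from one
  variable to all variables with the same distribution.
\<close>

definition clipped_powr :: "real \<Rightarrow> real \<Rightarrow> real \<Rightarrow> real" where
  "clipped_powr p N x = (min N \<bar>x\<bar>) powr p"

text \<open>
  With \<open>t = a / b\<close> the claim reduces to \<open>1 - t powr p \<le> 2 * (1 - t)\<close>, which follows from \<open>t\<^sup>2 \<le> t powr p\<close>.
\<close>

lemma powr_diff_le:
  fixes a b p :: real
  assumes "0 \<le> a" "a \<le> b" "b \<le> N" "1 \<le> p" "p \<le> 2" "0 < N"
  shows "b powr p - a powr p \<le> 2 * N powr (p - 1) * (b - a)"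
proof (cases "b = 0")
  case False
  then have b: "0 < b" using assms by auto
  define t where "t = a / b"
  have t: "0 \<le> t" "t \<le> 1" unfolding t_def using assms b by auto
  have t2: "t\<^sup>2 \<le> t powr p" using t assms by (intro square_le_powr)
  have "1 - t powr p \<le> (1 - t) * (1 + t)" using t2 by (simp add: power2_eq_square algebra_simps)
  also have "\<dots> \<le> (1 - t) * 2" using t by (intro mult_left_mono) auto
  finally have *: "1 - t powr p \<le> 2 * (1 - t)" by simp
  have "b powr p - a powr p = b powr p * (1 - t powr p)"
    unfolding t_def using assms b by (simp add: powr_divide field_simps)
  also have "\<dots> \<le> b powr p * (2 * (1 - t))" using * by (intro mult_left_mono) auto
  also have "b powr p * (2 * (1 - t)) = b powr (p - 1) * b * (2 * (1 - t))"
    using b by (simp add: powr_diff)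
  also have "\<dots> = 2 * b powr (p - 1) * (b - a)"
    unfolding t_def using b by (simp add: field_simps)
  also have "\<dots> \<le> 2 * N powr (p - 1) * (b - a)"
    using assms b by (intro mult_right_mono mult_left_mono powr_mono2) auto
  finally show ?thesis .
qed (use assms in auto)

lemma bounded_lipschitz_clipped_powr:
  assumes "0 < N" "1 \<le> p" "p \<le> 2"
  shows "bounded_lipschitz (clipped_powr p N)"
  unfolding bounded_lipschitz_def
proof (intro conjI exI allI)
  show "\<bar>clipped_powr p N t\<bar> \<le> N powr p" for t
    using assms unfolding clipped_powr_def by (auto intro!: powr_mono2)
  fix s t :: real
  have *: "\<bar>u powr p - v powr p\<bar> \<le> 2 * N powr (p - 1) * \<bar>u - v\<bar>"
    if "0 \<le> u" "0 \<le> v" "u \<le> N" "v \<le> N" for u v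
    using powr_diff_le[of u v N p] powr_diff_le[of v u N p] assms that powr_mono2[of p u v] powr_mono2[of p v u]
    by (cases "u \<le> v") auto
  have "\<bar>clipped_powr p N s - clipped_powr p N t\<bar> \<le> 2 * N powr (p - 1) * \<bar>min N \<bar>s\<bar> - min N \<bar>t\<bar>\<bar>"
    unfolding clipped_powr_def using assms by (intro *) auto
  also have "\<dots> \<le> 2 * N powr (p - 1) * \<bar>s - t\<bar>"
    by (intro mult_left_mono) auto
  finally show "\<bar>clipped_powr p N s - clipped_powr p N t\<bar> \<le> 2 * N powr (p - 1) * \<bar>s - t\<bar>" .
qed

section \<open>Sublinear expectations\<close>

text \<open>
  The supremum that defines \<open>sublin_expectation\<close> is meaningful only for families that are bounded above;
  hence the explicit uniform bounds in the following lemmas.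
\<close>

lemma integral_le_sublin_expectation:
  assumes "P \<in> \<Theta>" "\<And>Q. Q \<in> \<Theta> \<Longrightarrow> (\<integral>\<omega>. X \<omega> \<partial>Q) \<le> B"
  shows "(\<integral>\<omega>. X \<omega> \<partial>P) \<le> sublin_expectation \<Theta> X"
  unfolding sublin_expectation_def using assms by (intro cSUP_upper bdd_aboveI2) auto

lemma sublin_expectation_least:
  assumes "\<Theta> \<noteq> {}" "\<And>Q. Q \<in> \<Theta> \<Longrightarrow> (\<integral>\<omega>. X \<omega> \<partial>Q) \<le> B"
  shows "sublin_expectation \<Theta> X \<le> B"
  unfolding sublin_expectation_def using assms by (intro cSUP_least) auto

lemma sublin_expectation_affine:
  assumes ne: "\<Theta> \<noteq> {}" and prob: "\<And>Q. Q \<in> \<Theta> \<Longrightarrow> prob_space Q"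
    and int: "\<And>Q. Q \<in> \<Theta> \<Longrightarrow> integrable Q X"
    and bd: "\<And>Q. Q \<in> \<Theta> \<Longrightarrow> (\<integral>\<omega>. X \<omega> \<partial>Q) \<le> B" and "0 \<le> a"
  shows "sublin_expectation \<Theta> (\<lambda>\<omega>. a * X \<omega> + b) = a * sublin_expectation \<Theta> X + b"
proof -
  have eq: "(\<integral>\<omega>. a * X \<omega> + b \<partial>Q) = a * (\<integral>\<omega>. X \<omega> \<partial>Q) + b" if "Q \<in> \<Theta>" for Q
  proof -
    interpret prob_space Q using prob that .
    show ?thesis using int[OF that] by (simp add: prob_space)
  qed
  have le: "sublin_expectation \<Theta> (\<lambda>\<omega>. a * X \<omega> + b) \<le> a * sublin_expectation \<Theta> X + b"
  proof (rule sublin_expectation_least[OF ne])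
    fix Q assume Q: "Q \<in> \<Theta>"
    then show "(\<integral>\<omega>. a * X \<omega> + b \<partial>Q) \<le> a * sublin_expectation \<Theta> X + b"
      unfolding eq[OF Q] using \<open>0 \<le> a\<close> bd by (intro add_right_mono mult_left_mono integral_le_sublin_expectation)
  qed
  have le2: "a * (\<integral>\<omega>. X \<omega> \<partial>Q) + b \<le> sublin_expectation \<Theta> (\<lambda>\<omega>. a * X \<omega> + b)" if "Q \<in> \<Theta>" for Q
    unfolding eq[OF that, symmetric]
  proof (rule integral_le_sublin_expectation[OF that])
    fix Q' assume Q: "Q' \<in> \<Theta>"
    then show "(\<integral>\<omega>. a * X \<omega> + b \<partial>Q') \<le> a * B + b"
      unfolding eq[OF Q] using \<open>0 \<le> a\<close> bd by (intro add_right_mono mult_left_mono)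
  qed
  have "a * sublin_expectation \<Theta> X + b \<le> sublin_expectation \<Theta> (\<lambda>\<omega>. a * X \<omega> + b)"
  proof (cases "a = 0")
    case True
    then show ?thesis using le2 ne by auto
  next
    case False
    then have "0 < a" using \<open>0 \<le> a\<close> by simp
    have "sublin_expectation \<Theta> X \<le> (sublin_expectation \<Theta> (\<lambda>\<omega>. a * X \<omega> + b) - b) / a"
      by (rule sublin_expectation_least[OF ne]) (use le2 \<open>0 < a\<close> in \<open>simp add: field_simps\<close>)
    then show ?thesis using \<open>0 < a\<close> by (simp add: field_simps)
  qed
  with le show ?thesis by simp
qed

lemma sublin_expectation_perturb:
  assumes ne: "\<Theta> \<noteq> {}"
    and close: "\<And>Q. Q \<in> \<Theta> \<Longrightarrow> \<bar>(\<integral>\<omega>. X \<omega> \<partial>Q) - (\<integral>\<omega>. Y \<omega> \<partial>Q)\<bar> \<le> e"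
    and bd: "\<And>Q. Q \<in> \<Theta> \<Longrightarrow> (\<integral>\<omega>. Y \<omega> \<partial>Q) \<le> B"
  shows "\<bar>sublin_expectation \<Theta> X - sublin_expectation \<Theta> Y\<bar> \<le> e"
proof -
  have bdX: "(\<integral>\<omega>. X \<omega> \<partial>Q) \<le> B + e" if "Q \<in> \<Theta>" for Q
    using close[OF that] bd[OF that] by linarith
  have "sublin_expectation \<Theta> X \<le> sublin_expectation \<Theta> Y + e"
  proof (rule sublin_expectation_least[OF ne])
    fix Q assume Q: "Q \<in> \<Theta>"
    show "(\<integral>\<omega>. X \<omega> \<partial>Q) \<le> sublin_expectation \<Theta> Y + e"
      using integral_le_sublin_expectation[OF Q bd] close[OF Q] by linarith
  qed
  moreover have "sublin_expectation \<Theta> Y \<le> sublin_expectation \<Theta> X + e"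
  proof (rule sublin_expectation_least[OF ne])
    fix Q assume Q: "Q \<in> \<Theta>"
    show "(\<integral>\<omega>. Y \<omega> \<partial>Q) \<le> sublin_expectation \<Theta> X + e"
      using integral_le_sublin_expectation[OF Q bdX] close[OF Q] by linarith
  qed
  ultimately show ?thesis by linarith
qed

text \<open>
  All truncation errors below are multiples of \<open>N powr (1 - p)\<close>; this removes them in the limit.
\<close>

lemma le_of_vanishing_powr_error:
  fixes a b C p :: real
  assumes "1 < p" and le: "\<And>N::nat. 0 < N \<Longrightarrow> a \<le> b + C * real N powr (1 - p)"
  shows "a \<le> b"
proof (rule LIMSEQ_le_const)
  have "(\<lambda>N. b + C * real N powr (1 - p)) \<longlonglongrightarrow> b + C * 0"
    using assms(1) by (intro tendsto_intros tendsto_neg_powr filterlim_real_sequentially) auto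
  then show "(\<lambda>N. b + C * real N powr (1 - p)) \<longlonglongrightarrow> b" by simp
  show "\<exists>N. \<forall>n\<ge>N. a \<le> b + C * real n powr (1 - p)" using le by (intro exI[of _ 1]) auto
qed


section \<open>Independent and identically distributed sequences with a bounded moment\<close>

text \<open>
  The exponent is at most 2, as the Taylor remainder requires; a larger integrability exponent is
  lowered to this range in the application.
\<close>

locale iid_sublinear =
  fixes \<Theta> :: "'a::polish_space measure set" and \<xi> :: "nat \<Rightarrow> 'a \<Rightarrow> real" and p K :: real
  assumes nonempty: "\<Theta> \<noteq> {}"
    and borel_prob: "\<And>P. P \<in> \<Theta> \<Longrightarrow> P \<in> space (prob_algebra borel)"
    and meas: "\<And>k. 1 \<le> k \<Longrightarrow> \<xi> k \<in> borel_measurable borel"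
    and iid: "iid_seq \<Theta> \<xi>"
    and p: "1 < p" "p \<le> 2"
    and K: "0 \<le> K"
    and moment_1: "\<And>P. P \<in> \<Theta> \<Longrightarrow> (\<integral>\<^sup>+\<omega>. ennreal (\<bar>\<xi> 1 \<omega>\<bar> powr p) \<partial>P) \<le> ennreal K"
begin

lemma prob: "P \<in> \<Theta> \<Longrightarrow> prob_space P"
  using borel_prob by (simp add: space_prob_algebra)

lemma borel_measurable_eq: "P \<in> \<Theta> \<Longrightarrow> (borel_measurable P :: ('a \<Rightarrow> real) set) = borel_measurable borel"
  using borel_prob by (intro measurable_cong_sets) (simp_all add: space_prob_algebra)

lemma bounded_integral:
  fixes X :: "'a \<Rightarrow> real"
  assumes "P \<in> \<Theta>" "X \<in> borel_measurable borel" "\<And>\<omega>. \<bar>X \<omega>\<bar> \<le> B"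
  shows "integrable P X" "\<bar>\<integral>\<omega>. X \<omega> \<partial>P\<bar> \<le> B"
proof -
  interpret prob_space P using prob assms(1) .
  show i: "integrable P X"
    using assms borel_measurable_eq by (intro integrable_const_bound[where B = B]) auto
  have "\<bar>\<integral>\<omega>. X \<omega> \<partial>P\<bar> \<le> (\<integral>\<omega>. \<bar>X \<omega>\<bar> \<partial>P)" by (rule integral_abs_bound)
  also have "\<dots> \<le> B" using i assms(3) by (intro integral_le_const) auto
  finally show "\<bar>\<integral>\<omega>. X \<omega> \<partial>P\<bar> \<le> B" .
qed

text \<open>
  Identity in distribution relates neighbouring members only, so it is chained back to the first.
\<close>

lemma ident_distr_first:
  assumes "bounded_lipschitz f" "1 \<le> k"
  shows "sublin_expectation \<Theta> (\<lambda>\<omega>. f (\<xi> k \<omega>)) = sublin_expectation \<Theta> (\<lambda>\<omega>. f (\<xi> 1 \<omega>))"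
  using assms(2)
proof (induction k rule: dec_induct)
  case (step k)
  have "ident_distr \<Theta> 1 (\<lambda>\<omega>. [\<xi> (Suc k) \<omega>]) (\<lambda>\<omega>. [\<xi> k \<omega>])"
    using iid step.hyps unfolding iid_seq_def by auto
  from this[unfolded ident_distr_def, rule_format, OF Cb_Lip_nth[OF assms(1)], of 0]
  show ?case using step.IH by simp
qed simp

text \<open>
  \<open>\<bar>x\<bar> powr p\<close> is not a test function, so its truncations are compared with those of \<open>\<xi> 1\<close>, and
  Fatou's lemma passes to the limit.
\<close>

lemma moment:
  assumes P: "P \<in> \<Theta>" and k: "1 \<le> k"
  shows "(\<integral>\<^sup>+\<omega>. ennreal (\<bar>\<xi> k \<omega>\<bar> powr p) \<partial>P) \<le> ennreal K"
proof -
  have [measurable]: "\<xi> k \<in> borel_measurable P" using meas[OF k] borel_measurable_eq[OF P] by simp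
  have bl: "bounded_lipschitz (clipped_powr p (real (Suc N)))" for N
    using p by (intro bounded_lipschitz_clipped_powr) auto
  note bl_meas = bounded_lipschitz_measurable[OF bl]
  have nn: "0 \<le> clipped_powr p (real (Suc N)) x" for N x unfolding clipped_powr_def by simp
  have bd: "\<bar>clipped_powr p (real (Suc N)) x\<bar> \<le> real (Suc N) powr p" for N x
    unfolding clipped_powr_def using p by (auto intro!: powr_mono2)
  have N: "(\<integral>\<^sup>+\<omega>. ennreal (clipped_powr p (real (Suc N)) (\<xi> k \<omega>)) \<partial>P) \<le> ennreal K" for N
  proof -
    let ?f = "clipped_powr p (real (Suc N))"
    have "(\<integral>\<^sup>+\<omega>. ennreal (?f (\<xi> k \<omega>)) \<partial>P) = ennreal (\<integral>\<omega>. ?f (\<xi> k \<omega>) \<partial>P)"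
      using P nn bd meas[OF k] bl_meas
      by (intro nn_integral_eq_integral bounded_integral(1) AE_I2) (auto intro: measurable_compose)
    also have "\<dots> \<le> ennreal K"
    proof (rule ennreal_leI)
      have "(\<integral>\<omega>. ?f (\<xi> k \<omega>) \<partial>P) \<le> sublin_expectation \<Theta> (\<lambda>\<omega>. ?f (\<xi> k \<omega>))"
        using P bounded_integral(2)[of _ "\<lambda>\<omega>. ?f (\<xi> k \<omega>)", OF _ measurable_compose[OF meas[OF k] bl_meas] bd]
        by (intro integral_le_sublin_expectation) (auto simp: abs_le_iff)
      also have "\<dots> = sublin_expectation \<Theta> (\<lambda>\<omega>. ?f (\<xi> 1 \<omega>))"
        by (rule ident_distr_first[OF bl k])
      also have "\<dots> \<le> K"
      proof (rule sublin_expectation_least[OF nonempty])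
        fix Q assume Q: "Q \<in> \<Theta>"
        have "ennreal (\<integral>\<omega>. ?f (\<xi> 1 \<omega>) \<partial>Q) = (\<integral>\<^sup>+\<omega>. ennreal (?f (\<xi> 1 \<omega>)) \<partial>Q)"
          using Q nn bd meas[of 1] bl_meas
          by (intro nn_integral_eq_integral[symmetric] bounded_integral(1) AE_I2) (auto intro: measurable_compose)
        also have "\<dots> \<le> (\<integral>\<^sup>+\<omega>. ennreal (\<bar>\<xi> 1 \<omega>\<bar> powr p) \<partial>Q)"
          using p by (intro nn_integral_mono ennreal_leI) (auto simp: clipped_powr_def intro!: powr_mono2)
        also have "\<dots> \<le> ennreal K" by (rule moment_1[OF Q])
        finally show "(\<integral>\<omega>. ?f (\<xi> 1 \<omega>) \<partial>Q) \<le> K" using K by simp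
      qed
      finally show "(\<integral>\<omega>. ?f (\<xi> k \<omega>) \<partial>P) \<le> K" .
    qed
    finally show ?thesis .
  qed
  have lim: "liminf (\<lambda>N. ennreal (clipped_powr p (real (Suc N)) x)) = ennreal (\<bar>x\<bar> powr p)" for x
  proof -
    obtain N0 :: nat where "\<bar>x\<bar> \<le> real N0" using real_arch_simple by blast
    then have "\<forall>\<^sub>F N in sequentially. ennreal (clipped_powr p (real (Suc N)) x) = ennreal (\<bar>x\<bar> powr p)"
      unfolding eventually_sequentially clipped_powr_def by (intro exI[of _ N0]) (auto simp: min_def)
    then have "(\<lambda>N. ennreal (clipped_powr p (real (Suc N)) x)) \<longlonglongrightarrow> ennreal (\<bar>x\<bar> powr p)"
      by (rule tendsto_eventually)
    then show ?thesis by (intro lim_imp_Liminf) auto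
  qed
  have "(\<integral>\<^sup>+\<omega>. ennreal (\<bar>\<xi> k \<omega>\<bar> powr p) \<partial>P)
      = (\<integral>\<^sup>+\<omega>. liminf (\<lambda>N. ennreal (clipped_powr p (real (Suc N)) (\<xi> k \<omega>))) \<partial>P)"
    unfolding lim ..
  also have "\<dots> \<le> liminf (\<lambda>N. \<integral>\<^sup>+\<omega>. ennreal (clipped_powr p (real (Suc N)) (\<xi> k \<omega>)) \<partial>P)"
    using bl_meas by (intro nn_integral_liminf) (auto intro: measurable_compose)
  also have "\<dots> \<le> liminf (\<lambda>N::nat. ennreal K)"
    using N by (intro Liminf_mono always_eventually allI)
  also have "\<dots> = ennreal K" by (simp add: Liminf_const)
  finally show ?thesis .
qed

lemma moment_integral:
  assumes P: "P \<in> \<Theta>" and k: "1 \<le> k"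
  shows "integrable P (\<lambda>\<omega>. \<bar>\<xi> k \<omega>\<bar> powr p)" "(\<integral>\<omega>. \<bar>\<xi> k \<omega>\<bar> powr p \<partial>P) \<le> K"
proof -
  have [measurable]: "\<xi> k \<in> borel_measurable P" using meas[OF k] borel_measurable_eq[OF P] by simp
  show i: "integrable P (\<lambda>\<omega>. \<bar>\<xi> k \<omega>\<bar> powr p)"
    using moment[OF P k] by (intro integrableI_bounded) (auto intro: le_less_trans)
  show "(\<integral>\<omega>. \<bar>\<xi> k \<omega>\<bar> powr p \<partial>P) \<le> K"
    using moment[OF P k] i K by (subst (asm) nn_integral_eq_integral) auto
qed

lemma integrable_xi:
  assumes P: "P \<in> \<Theta>" and k: "1 \<le> k"
  shows "integrable P (\<xi> k)"
proof -
  interpret prob_space P using prob P .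
  show ?thesis
  proof (rule Bochner_Integration.integrable_bound)
    show "integrable P (\<lambda>\<omega>. 1 + 1 powr (1 - p) * \<bar>\<xi> k \<omega>\<bar> powr p)" using moment_integral[OF P k] by simp
    show "\<xi> k \<in> borel_measurable P" using meas[OF k] borel_measurable_eq[OF P] by simp
    show "AE \<omega> in P. norm (\<xi> k \<omega>) \<le> norm (1 + 1 powr (1 - p) * \<bar>\<xi> k \<omega>\<bar> powr p)"
      using abs_le_weighted_powr[of 1 p] p by (intro AE_I2) (simp add: add_nonneg_nonneg)
  qed
qed

lemma clip_mean_error:
  assumes P: "P \<in> \<Theta>" and k: "1 \<le> k" and N: "0 < N"
  shows "integrable P (\<lambda>\<omega>. clip N (\<xi> k \<omega>))"
    and "(\<integral>\<omega>. \<bar>\<xi> k \<omega> - clip N (\<xi> k \<omega>)\<bar> \<partial>P) \<le> K * N powr (1 - p)"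
proof -
  show i: "integrable P (\<lambda>\<omega>. clip N (\<xi> k \<omega>))"
    using N abs_clip_le[of N] meas[OF k]
    by (intro bounded_integral(1)[OF P, where B = N]) (auto intro: measurable_compose)
  have "(\<integral>\<omega>. \<bar>\<xi> k \<omega> - clip N (\<xi> k \<omega>)\<bar> \<partial>P) \<le> (\<integral>\<omega>. N powr (1 - p) * \<bar>\<xi> k \<omega>\<bar> powr p \<partial>P)"
    using i integrable_xi[OF P k] moment_integral(1)[OF P k] clip_error[OF N] p
    by (intro integral_mono) auto
  also have "\<dots> = N powr (1 - p) * (\<integral>\<omega>. \<bar>\<xi> k \<omega>\<bar> powr p \<partial>P)" by simp
  also have "\<dots> \<le> N powr (1 - p) * K"
    using moment_integral(2)[OF P k] by (intro mult_left_mono) auto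
  finally show "(\<integral>\<omega>. \<bar>\<xi> k \<omega> - clip N (\<xi> k \<omega>)\<bar> \<partial>P) \<le> K * N powr (1 - p)" by (simp add: mult.commute)
qed

lemma clip_scaled_error:
  assumes P: "P \<in> \<Theta>" and k: "1 \<le> k" and N: "0 < N"
  shows "\<bar>(\<integral>\<omega>. c * \<xi> k \<omega> \<partial>P) - (\<integral>\<omega>. c * clip N (\<xi> k \<omega>) \<partial>P)\<bar> \<le> \<bar>c\<bar> * (K * N powr (1 - p))"
proof -
  have "\<bar>(\<integral>\<omega>. c * \<xi> k \<omega> \<partial>P) - (\<integral>\<omega>. c * clip N (\<xi> k \<omega>) \<partial>P)\<bar> = \<bar>c\<bar> * \<bar>\<integral>\<omega>. \<xi> k \<omega> - clip N (\<xi> k \<omega>) \<partial>P\<bar>"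
    using integrable_xi[OF P k] clip_mean_error(1)[OF assms] by (simp flip: abs_mult right_diff_distrib)
  also have "\<dots> \<le> \<bar>c\<bar> * (\<integral>\<omega>. \<bar>\<xi> k \<omega> - clip N (\<xi> k \<omega>)\<bar> \<partial>P)"
    by (intro mult_left_mono integral_abs_bound) auto
  also have "\<dots> \<le> \<bar>c\<bar> * (K * N powr (1 - p))"
    using clip_mean_error(2)[OF assms] by (intro mult_left_mono) auto
  finally show ?thesis .
qed

text \<open>
  For \<open>c = 1\<close> and \<open>c = - 1\<close> these are the upper mean and minus the lower mean of the sequence.
\<close>

definition upper :: "real \<Rightarrow> real" where
  "upper c = sublin_expectation \<Theta> (\<lambda>\<omega>. c * \<xi> 1 \<omega>)"

definition upper_clip :: "real \<Rightarrow> real \<Rightarrow> real" where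
  "upper_clip N c = sublin_expectation \<Theta> (\<lambda>\<omega>. c * clip N (\<xi> 1 \<omega>))"

lemma clip_scaled_bounded:
  assumes "P \<in> \<Theta>" "1 \<le> k" "0 < N"
  shows "(\<integral>\<omega>. c * clip N (\<xi> k \<omega>) \<partial>P) \<le> \<bar>c\<bar> * N"
proof -
  have "\<bar>\<integral>\<omega>. c * clip N (\<xi> k \<omega>) \<partial>P\<bar> \<le> \<bar>c\<bar> * N"
    using abs_clip_le[of N] meas assms
    by (intro bounded_integral(2)) (auto intro!: measurable_compose[OF _ borel_measurable_clip] mult_left_mono simp: abs_mult)
  then show ?thesis by linarith
qed

lemma upper_clip_ident:
  assumes "1 \<le> k" "0 < N"
  shows "sublin_expectation \<Theta> (\<lambda>\<omega>. c * clip N (\<xi> k \<omega>)) = upper_clip N c"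
  unfolding upper_clip_def using assms
  by (intro ident_distr_first[where f = "\<lambda>x. c * clip N x"] bounded_lipschitz_cmult_clip) auto

lemma upper_clip_error:
  assumes "0 < N"
  shows "\<bar>upper c - upper_clip N c\<bar> \<le> \<bar>c\<bar> * (K * N powr (1 - p))"
  unfolding upper_def upper_clip_def
  by (rule sublin_expectation_perturb[OF nonempty clip_scaled_error[OF _ order_refl assms]
      clip_scaled_bounded[OF _ order_refl assms]])

lemma integral_le_upper:
  assumes P: "P \<in> \<Theta>" and k: "1 \<le> k"
  shows "(\<integral>\<omega>. c * \<xi> k \<omega> \<partial>P) \<le> upper c"
proof (rule le_of_vanishing_powr_error[OF p(1)])
  fix N :: nat assume "0 < N"
  then have N: "0 < real N" by simp
  have "(\<integral>\<omega>. c * clip N (\<xi> k \<omega>) \<partial>P) \<le> upper_clip N c"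
    unfolding upper_clip_ident[OF k N, symmetric]
    by (rule integral_le_sublin_expectation[OF P clip_scaled_bounded[OF _ k N]])
  then show "(\<integral>\<omega>. c * \<xi> k \<omega> \<partial>P) \<le> upper c + (2 * \<bar>c\<bar> * K) * real N powr (1 - p)"
    using clip_scaled_error[OF P k N, of c] upper_clip_error[OF N, of c] by linarith
qed

text \<open>
  Given the past \<open>Y\<close>, the next variable may be replaced by its upper mean wherever it occurs with a
  nonnegative coefficient. The summand \<open>\<eta>\<close> serves two purposes: it is the sum of the earlier variables
  in the additivity lemma below, and it centres the next variable in the supermartingale inequality.
\<close>

lemma indep_clip:
  assumes \<psi>: "\<psi> \<in> Cb_Lip n" "\<And>y. length y = n \<Longrightarrow> 0 \<le> \<psi> y" and \<eta>: "\<eta> \<in> Cb_Lip n"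
    and n: "1 \<le> n" and N: "0 < N"
  defines "Y \<equiv> \<lambda>\<omega>. map (\<lambda>k. \<xi> k \<omega>) [1..<Suc n]"
  shows "sublin_expectation \<Theta> (\<lambda>\<omega>. \<psi> (Y \<omega>) * (c * clip N (\<xi> (Suc n) \<omega>)) + \<eta> (Y \<omega>))
    = sublin_expectation \<Theta> (\<lambda>\<omega>. \<psi> (Y \<omega>) * upper_clip N c + \<eta> (Y \<omega>))"
proof -
  define \<phi> where "\<phi> z = \<psi> (take n z) * (c * clip N (z ! n)) + \<eta> (take n z)" for z
  have lenY: "length (Y \<omega>) = n" for \<omega> unfolding Y_def by simp
  have \<phi>: "\<phi> \<in> Cb_Lip (n + 1)"
    unfolding \<phi>_def using \<psi> \<eta> N
    by (intro Cb_Lip_add Cb_Lip_mult Cb_Lip_take Cb_Lip_nth bounded_lipschitz_cmult_clip) auto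
  have \<phi>_append: "\<phi> (y @ [x]) = \<psi> y * (c * clip N x) + \<eta> y" if "length y = n" for y x
    unfolding \<phi>_def using that by (simp add: nth_append)
  have "sublin_expectation \<Theta> (\<lambda>\<omega>. \<phi> (Y \<omega> @ [\<xi> (Suc n) \<omega>]))
      = sublin_expectation \<Theta> (\<lambda>\<omega>. sublin_expectation \<Theta> (\<lambda>\<omega>'. \<phi> (Y \<omega> @ [\<xi> (Suc n) \<omega>'])))"
    using iid n \<phi> unfolding iid_seq_def indep_of_def Y_def by blast
  also have "\<dots> = sublin_expectation \<Theta> (\<lambda>\<omega>. \<psi> (Y \<omega>) * upper_clip N c + \<eta> (Y \<omega>))"
  proof (rule arg_cong[where f = "sublin_expectation \<Theta>"], rule ext)
    fix \<omega>
    have "sublin_expectation \<Theta> (\<lambda>\<omega>'. \<psi> (Y \<omega>) * (c * clip N (\<xi> (Suc n) \<omega>')) + \<eta> (Y \<omega>))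
        = \<psi> (Y \<omega>) * sublin_expectation \<Theta> (\<lambda>\<omega>'. c * clip N (\<xi> (Suc n) \<omega>')) + \<eta> (Y \<omega>)"
    proof (rule sublin_expectation_affine[OF nonempty prob _ clip_scaled_bounded[OF _ _ N]])
      show "integrable Q (\<lambda>\<omega>'. c * clip N (\<xi> (Suc n) \<omega>'))" if "Q \<in> \<Theta>" for Q
        using clip_mean_error(1)[OF that _ N, of "Suc n"] by simp
    qed (use \<psi>(2)[OF lenY] in auto)
    then show "sublin_expectation \<Theta> (\<lambda>\<omega>'. \<phi> (Y \<omega> @ [\<xi> (Suc n) \<omega>'])) = \<psi> (Y \<omega>) * upper_clip N c + \<eta> (Y \<omega>)"
      unfolding \<phi>_append[OF lenY] using upper_clip_ident[OF _ N, of "Suc n" c] by simp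
  qed
  finally show ?thesis unfolding \<phi>_append[OF lenY] .
qed

text \<open>
  Additivity along an independent sequence: integrating out the last variable leaves a constant.
\<close>

lemma sublin_expectation_sum_clip:
  assumes N: "0 < N" and n: "1 \<le> n"
  shows "sublin_expectation \<Theta> (\<lambda>\<omega>. \<Sum>i=1..n. c i * clip N (\<xi> i \<omega>)) = (\<Sum>i=1..n. upper_clip N (c i))"
  using n
proof (induction n rule: dec_induct)
  case base
  show ?case by (simp add: upper_clip_def)
next
  case (step n)
  let ?\<eta> = "\<lambda>y. \<Sum>i<n. c (Suc i) * clip N (y ! i)"
  have \<eta>: "?\<eta> \<in> Cb_Lip n"
    using N by (intro Cb_Lip_sum Cb_Lip_nth bounded_lipschitz_cmult_clip) auto
  have \<eta>_Y: "?\<eta> (map (\<lambda>k. \<xi> k \<omega>) [1..<Suc n]) = (\<Sum>i=1..n. c i * clip N (\<xi> i \<omega>))" for \<omega>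
    by (rule sum.reindex_bij_witness[of _ "\<lambda>i. i - 1" Suc]) (auto simp del: upt_Suc)
  have "sublin_expectation \<Theta> (\<lambda>\<omega>. \<Sum>i=1..Suc n. c i * clip N (\<xi> i \<omega>))
      = sublin_expectation \<Theta> (\<lambda>\<omega>. 1 * (c (Suc n) * clip N (\<xi> (Suc n) \<omega>)) + ?\<eta> (map (\<lambda>k. \<xi> k \<omega>) [1..<Suc n]))"
    unfolding \<eta>_Y by (simp add: add.commute)
  also have "\<dots> = sublin_expectation \<Theta> (\<lambda>\<omega>. 1 * upper_clip N (c (Suc n)) + ?\<eta> (map (\<lambda>k. \<xi> k \<omega>) [1..<Suc n]))"
    using step.hyps N by (intro indep_clip[where \<psi> = "\<lambda>_. 1"] \<eta> Cb_Lip_const) auto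
  also have "\<dots> = sublin_expectation \<Theta> (\<lambda>\<omega>. 1 * (\<Sum>i=1..n. c i * clip N (\<xi> i \<omega>)) + upper_clip N (c (Suc n)))"
    unfolding \<eta>_Y by (simp add: add.commute)
  also have "\<dots> = 1 * sublin_expectation \<Theta> (\<lambda>\<omega>. \<Sum>i=1..n. c i * clip N (\<xi> i \<omega>)) + upper_clip N (c (Suc n))"
  proof (rule sublin_expectation_affine[OF nonempty prob])
    fix Q assume Q: "Q \<in> \<Theta>"
    have i: "integrable Q (\<lambda>\<omega>. c i * clip N (\<xi> i \<omega>))" if "i \<in> {1..n}" for i
      using that clip_mean_error(1)[OF Q _ N, of i] by simp
    then show "integrable Q (\<lambda>\<omega>. \<Sum>i=1..n. c i * clip N (\<xi> i \<omega>))" by (rule Bochner_Integration.integrable_sum)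
    have "(\<integral>\<omega>. (\<Sum>i=1..n. c i * clip N (\<xi> i \<omega>)) \<partial>Q) = (\<Sum>i=1..n. \<integral>\<omega>. c i * clip N (\<xi> i \<omega>) \<partial>Q)"
      using i by (rule Bochner_Integration.integral_sum)
    also have "\<dots> \<le> (\<Sum>i=1..n. \<bar>c i\<bar> * N)"
      using Q N by (intro sum_mono clip_scaled_bounded) auto
    finally show "(\<integral>\<omega>. (\<Sum>i=1..n. c i * clip N (\<xi> i \<omega>)) \<partial>Q) \<le> (\<Sum>i=1..n. \<bar>c i\<bar> * N)" .
  qed auto
  finally show ?case using step.IH by simp
qed

text \<open>
  A measure that is nearly optimal for the truncated sum is nearly optimal for the sum itself, once the
  truncation level makes the \<open>n\<close> truncation errors together smaller than \<open>e / 2\<close>.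
\<close>

lemma exists_near_optimal:
  assumes n: "1 \<le> n" and e: "0 < e" and c: "\<And>i. \<bar>c i\<bar> \<le> 1"
  shows "\<exists>P\<in>\<Theta>. (\<Sum>i=1..n. upper (c i) - (\<integral>\<omega>. c i * \<xi> i \<omega> \<partial>P)) \<le> e"
proof -
  have "(\<lambda>N. real n * (2 * (K * real N powr (1 - p)))) \<longlonglongrightarrow> real n * (2 * (K * 0))"
    using p by (intro tendsto_intros tendsto_neg_powr filterlim_real_sequentially) auto
  then have "\<forall>\<^sub>F N in sequentially. real n * (2 * (K * real N powr (1 - p))) < e / 2"
    using e by (intro order_tendstoD) auto
  then have "\<forall>\<^sub>F N in sequentially. 0 < N \<and> real n * (2 * (K * real N powr (1 - p))) < e / 2"
    using eventually_gt_at_top[of 0] by eventually_elim auto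
  then obtain N :: nat where "0 < N" and Ne: "real n * (2 * (K * real N powr (1 - p))) < e / 2"
    using eventually_happens' sequentially_bot by blast
  then have N: "0 < real N" by simp
  have "\<exists>P\<in>\<Theta>. (\<Sum>i=1..n. upper_clip N (c i)) - e / 2 < (\<integral>\<omega>. (\<Sum>i=1..n. c i * clip N (\<xi> i \<omega>)) \<partial>P)"
  proof (rule ccontr)
    assume "\<not> ?thesis"
    then have "sublin_expectation \<Theta> (\<lambda>\<omega>. \<Sum>i=1..n. c i * clip N (\<xi> i \<omega>)) \<le> (\<Sum>i=1..n. upper_clip N (c i)) - e / 2"
      by (intro sublin_expectation_least[OF nonempty]) (auto simp: not_less)
    then show False using sublin_expectation_sum_clip[OF N n, of c] e by simp
  qed
  then obtain P where P: "P \<in> \<Theta>"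
    and lt: "(\<Sum>i=1..n. upper_clip N (c i)) - e / 2 < (\<integral>\<omega>. (\<Sum>i=1..n. c i * clip N (\<xi> i \<omega>)) \<partial>P)"
    by blast
  have "(\<integral>\<omega>. (\<Sum>i=1..n. c i * clip N (\<xi> i \<omega>)) \<partial>P) = (\<Sum>i=1..n. \<integral>\<omega>. c i * clip N (\<xi> i \<omega>) \<partial>P)"
    using clip_mean_error(1)[OF P _ N] by (intro Bochner_Integration.integral_sum) auto
  then have small: "(\<Sum>i=1..n. upper_clip N (c i) - (\<integral>\<omega>. c i * clip N (\<xi> i \<omega>) \<partial>P)) \<le> e / 2"
    using lt by (simp add: sum_subtractf)
  have "(\<Sum>i=1..n. upper (c i) - (\<integral>\<omega>. c i * \<xi> i \<omega> \<partial>P))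
      \<le> (\<Sum>i=1..n. (upper_clip N (c i) - (\<integral>\<omega>. c i * clip N (\<xi> i \<omega>) \<partial>P)) + 2 * (K * real N powr (1 - p)))"
  proof (rule sum_mono)
    fix i assume i: "i \<in> {1..n}"
    have "\<bar>c i\<bar> * (K * real N powr (1 - p)) \<le> 1 * (K * real N powr (1 - p))"
      using c K by (intro mult_right_mono) auto
    then show "upper (c i) - (\<integral>\<omega>. c i * \<xi> i \<omega> \<partial>P)
        \<le> (upper_clip N (c i) - (\<integral>\<omega>. c i * clip N (\<xi> i \<omega>) \<partial>P)) + 2 * (K * real N powr (1 - p))"
      using clip_scaled_error[OF P _ N, of i "c i"] upper_clip_error[OF N, of "c i"] i by auto
  qed
  also have "\<dots> \<le> e"
    using small Ne unfolding sum.distrib by simp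
  finally show ?thesis using P by blast
qed

text \<open>
  For the truncated variable, conditioning on the past makes the sublinear expectation of
  \<open>\<psi> (Y) * (c * clip N (\<xi> (Suc n)) - upper_clip N c)\<close> equal to 0, hence the expectation under \<open>P\<close> is at most 0. As \<open>\<psi>\<close>
  is bounded, the truncation can be removed.
\<close>

lemma supermartingale_inequality:
  assumes P: "P \<in> \<Theta>" and \<psi>: "\<psi> \<in> Cb_Lip n" "\<And>y. length y = n \<Longrightarrow> 0 \<le> \<psi> y" and n: "1 \<le> n"
  defines "Y \<equiv> \<lambda>\<omega>. map (\<lambda>k. \<xi> k \<omega>) [1..<Suc n]"
  assumes \<psi>_meas: "(\<lambda>\<omega>. \<psi> (Y \<omega>)) \<in> borel_measurable borel"
  shows "(\<integral>\<omega>. \<psi> (Y \<omega>) * (c * \<xi> (Suc n) \<omega> - upper c) \<partial>P) \<le> 0"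
proof -
  interpret prob_space P using prob P .
  obtain B where B: "0 \<le> B" "\<And>y. length y = n \<Longrightarrow> \<bar>\<psi> y\<bar> \<le> B"
    using \<psi>(1) by (rule Cb_LipE) (blast intro: that)
  have BY: "\<bar>\<psi> (Y \<omega>)\<bar> \<le> B" for \<omega> unfolding Y_def by (rule B) simp
  note [measurable] = \<psi>_meas[folded borel_measurable_eq[OF P]]
  have prod_int: "integrable P (\<lambda>\<omega>. \<psi> (Y \<omega>) * Z \<omega>)" if Z: "integrable P Z" for Z
  proof (rule Bochner_Integration.integrable_bound)
    show "integrable P (\<lambda>\<omega>. B * Z \<omega>)" using Z by simp
    show "AE \<omega> in P. norm (\<psi> (Y \<omega>) * Z \<omega>) \<le> norm (B * Z \<omega>)"
      using BY B(1) by (intro AE_I2) (simp add: abs_mult mult_right_mono)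
  qed (use Z in measurable)
  show ?thesis
  proof (rule le_of_vanishing_powr_error[OF p(1)])
    fix N :: nat assume "0 < N"
    then have N: "0 < real N" by simp
    let ?E = "K * real N powr (1 - p)"
    have ix: "integrable P (\<lambda>\<omega>. c * \<xi> (Suc n) \<omega> - upper c)" "integrable P (\<lambda>\<omega>. c * clip N (\<xi> (Suc n) \<omega>) - upper_clip N c)"
      "integrable P (\<lambda>\<omega>. \<bar>\<xi> (Suc n) \<omega> - clip N (\<xi> (Suc n) \<omega>)\<bar>)"
      using integrable_xi[OF P, of "Suc n"] clip_mean_error(1)[OF P _ N, of "Suc n"] by auto
    have "sublin_expectation \<Theta> (\<lambda>\<omega>. \<psi> (Y \<omega>) * (c * clip N (\<xi> (Suc n) \<omega>)) + \<psi> (Y \<omega>) * (- upper_clip N c))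
        = sublin_expectation \<Theta> (\<lambda>\<omega>. \<psi> (Y \<omega>) * upper_clip N c + \<psi> (Y \<omega>) * (- upper_clip N c))"
      unfolding Y_def using n N
      by (intro indep_clip[where \<eta> = "\<lambda>y. \<psi> y * (- upper_clip N c)"] \<psi> Cb_Lip_mult Cb_Lip_const)
    also have "\<dots> = 0" using nonempty by (simp add: sublin_expectation_def)
    finally have zero: "sublin_expectation \<Theta> (\<lambda>\<omega>. \<psi> (Y \<omega>) * (c * clip N (\<xi> (Suc n) \<omega>) - upper_clip N c)) = 0"
      by (simp add: algebra_simps)
    have "(\<integral>\<omega>. \<psi> (Y \<omega>) * (c * clip N (\<xi> (Suc n) \<omega>) - upper_clip N c) \<partial>P) \<le> 0"
      unfolding zero[symmetric]
    proof (rule integral_le_sublin_expectation[OF P])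
      fix Q assume Q: "Q \<in> \<Theta>"
      let ?Z = "\<lambda>\<omega>. \<psi> (Y \<omega>) * (c * clip N (\<xi> (Suc n) \<omega>) - upper_clip N c)"
      have "\<bar>\<integral>\<omega>. ?Z \<omega> \<partial>Q\<bar> \<le> B * (\<bar>c\<bar> * N + \<bar>upper_clip N c\<bar>)"
      proof (rule bounded_integral(2)[OF Q])
        have "\<xi> (Suc n) \<in> borel_measurable borel" by (rule meas) simp
        then show "?Z \<in> borel_measurable borel" using \<psi>_meas by measurable
        fix \<omega>
        have "\<bar>c * clip N (\<xi> (Suc n) \<omega>) - upper_clip N c\<bar> \<le> \<bar>c * clip N (\<xi> (Suc n) \<omega>)\<bar> + \<bar>upper_clip N c\<bar>"
          by (rule abs_triangle_ineq4)
        also have "\<bar>c * clip N (\<xi> (Suc n) \<omega>)\<bar> \<le> \<bar>c\<bar> * N"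
          unfolding abs_mult by (intro mult_left_mono abs_clip_le) auto
        finally show "\<bar>?Z \<omega>\<bar> \<le> B * (\<bar>c\<bar> * N + \<bar>upper_clip N c\<bar>)"
          unfolding abs_mult[of "\<psi> (Y \<omega>)"] using BY B(1) by (intro mult_mono) auto
      qed
      then show "(\<integral>\<omega>. ?Z \<omega> \<partial>Q) \<le> B * (\<bar>c\<bar> * N + \<bar>upper_clip N c\<bar>)" by linarith
    qed
    moreover have "(\<integral>\<omega>. \<psi> (Y \<omega>) * (c * \<xi> (Suc n) \<omega> - upper c) \<partial>P)
        - (\<integral>\<omega>. \<psi> (Y \<omega>) * (c * clip N (\<xi> (Suc n) \<omega>) - upper_clip N c) \<partial>P) \<le> B * (2 * \<bar>c\<bar> * ?E)"
    proof -
      have "(\<integral>\<omega>. \<psi> (Y \<omega>) * (c * \<xi> (Suc n) \<omega> - upper c) \<partial>P)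
          - (\<integral>\<omega>. \<psi> (Y \<omega>) * (c * clip N (\<xi> (Suc n) \<omega>) - upper_clip N c) \<partial>P)
        = (\<integral>\<omega>. \<psi> (Y \<omega>) * (c * \<xi> (Suc n) \<omega> - upper c)
            - \<psi> (Y \<omega>) * (c * clip N (\<xi> (Suc n) \<omega>) - upper_clip N c) \<partial>P)"
        by (rule Bochner_Integration.integral_diff[symmetric]) (intro prod_int ix)+
      also have "\<dots> \<le> (\<integral>\<omega>. B * (\<bar>c\<bar> * \<bar>\<xi> (Suc n) \<omega> - clip N (\<xi> (Suc n) \<omega>)\<bar> + \<bar>c\<bar> * ?E) \<partial>P)"
      proof (rule integral_mono)
        fix \<omega>
        let ?d = "c * (\<xi> (Suc n) \<omega> - clip N (\<xi> (Suc n) \<omega>)) - (upper c - upper_clip N c)"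
        have d: "\<bar>?d\<bar> \<le> \<bar>c\<bar> * \<bar>\<xi> (Suc n) \<omega> - clip N (\<xi> (Suc n) \<omega>)\<bar> + \<bar>c\<bar> * ?E"
          using upper_clip_error[OF N, of c] abs_triangle_ineq4[of "c * (\<xi> (Suc n) \<omega> - clip N (\<xi> (Suc n) \<omega>))" "upper c - upper_clip N c"]
          unfolding abs_mult by linarith
        have "\<psi> (Y \<omega>) * (c * \<xi> (Suc n) \<omega> - upper c) - \<psi> (Y \<omega>) * (c * clip N (\<xi> (Suc n) \<omega>) - upper_clip N c) = \<psi> (Y \<omega>) * ?d"
          by (simp add: algebra_simps)
        also have "\<dots> \<le> \<bar>\<psi> (Y \<omega>)\<bar> * \<bar>?d\<bar>" by (metis abs_ge_self abs_mult)
        also have "\<dots> \<le> B * (\<bar>c\<bar> * \<bar>\<xi> (Suc n) \<omega> - clip N (\<xi> (Suc n) \<omega>)\<bar> + \<bar>c\<bar> * ?E)"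
          using d BY B(1) by (intro mult_mono) auto
        finally show "\<psi> (Y \<omega>) * (c * \<xi> (Suc n) \<omega> - upper c) - \<psi> (Y \<omega>) * (c * clip N (\<xi> (Suc n) \<omega>) - upper_clip N c)
          \<le> B * (\<bar>c\<bar> * \<bar>\<xi> (Suc n) \<omega> - clip N (\<xi> (Suc n) \<omega>)\<bar> + \<bar>c\<bar> * ?E)" .
      next
        show "integrable P (\<lambda>\<omega>. \<psi> (Y \<omega>) * (c * \<xi> (Suc n) \<omega> - upper c)
            - \<psi> (Y \<omega>) * (c * clip N (\<xi> (Suc n) \<omega>) - upper_clip N c))"
          by (intro Bochner_Integration.integrable_diff prod_int ix)
        show "integrable P (\<lambda>\<omega>. B * (\<bar>c\<bar> * \<bar>\<xi> (Suc n) \<omega> - clip N (\<xi> (Suc n) \<omega>)\<bar> + \<bar>c\<bar> * ?E))"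
          using ix(3) by simp
      qed
      also have "\<dots> = B * (\<bar>c\<bar> * (\<integral>\<omega>. \<bar>\<xi> (Suc n) \<omega> - clip N (\<xi> (Suc n) \<omega>)\<bar> \<partial>P) + \<bar>c\<bar> * ?E)"
        using ix(3) by (simp add: prob_space)
      also have "\<dots> \<le> B * (\<bar>c\<bar> * ?E + \<bar>c\<bar> * ?E)"
        using clip_mean_error(2)[OF P _ N, of "Suc n"] B(1) by (intro mult_left_mono add_right_mono) auto
      also have "\<dots> = B * (2 * \<bar>c\<bar> * ?E)" by (simp only: mult_2 distrib_right)
      finally show ?thesis .
    qed
    ultimately show "(\<integral>\<omega>. \<psi> (Y \<omega>) * (c * \<xi> (Suc n) \<omega> - upper c) \<partial>P) \<le> 0 + (B * (2 * \<bar>c\<bar> * K)) * real N powr (1 - p)"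
      by (simp add: mult.assoc)
  qed
qed

text \<open>
  An inequality for nonnegative test functions that is an equality for the constant 1 is an equality
  for all of them: apply it to \<open>1 + f\<close> and to \<open>1 - f\<close>.
\<close>

lemma martingale_difference:
  assumes P: "P \<in> \<Theta>" and n: "1 \<le> n"
    and opt: "(\<integral>\<omega>. c * \<xi> (Suc n) \<omega> \<partial>P) = upper c"
    and f1: "\<And>t. \<bar>f t\<bar> \<le> 1" and fL: "\<And>s t. \<bar>f s - f t\<bar> \<le> L * \<bar>s - t\<bar>"
  shows "(\<integral>\<omega>. f (\<Sum>i<n. \<xi> (Suc i) \<omega>) * (c * \<xi> (Suc n) \<omega> - upper c) \<partial>P) = 0"
proof -
  interpret prob_space P using prob P .
  let ?D = "\<lambda>\<omega>. c * \<xi> (Suc n) \<omega> - upper c"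
  let ?S = "\<lambda>\<omega>. \<Sum>i<n. \<xi> (Suc i) \<omega>"
  have fbl: "bounded_lipschitz f" unfolding bounded_lipschitz_def using f1 fL by blast
  have S_meas: "?S \<in> borel_measurable borel" using meas by (intro borel_measurable_sum) auto
  have fS_meas: "(\<lambda>\<omega>. f (?S \<omega>)) \<in> borel_measurable borel"
    by (rule measurable_compose[OF S_meas bounded_lipschitz_measurable[OF fbl]])
  have D: "integrable P ?D" "(\<integral>\<omega>. ?D \<omega> \<partial>P) = 0"
    using integrable_xi[OF P, of "Suc n"] opt by (auto simp: prob_space)
  have fD: "integrable P (\<lambda>\<omega>. f (?S \<omega>) * ?D \<omega>)"
  proof (rule Bochner_Integration.integrable_bound[OF D(1)])
    show "(\<lambda>\<omega>. f (?S \<omega>) * ?D \<omega>) \<in> borel_measurable P"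
      using fS_meas borel_measurable_eq[OF P]
      by (intro borel_measurable_times borel_measurable_integrable[OF D(1)]) simp
    show "AE \<omega> in P. norm (f (?S \<omega>) * ?D \<omega>) \<le> norm (?D \<omega>)"
      by (intro AE_I2) (metis abs_ge_zero abs_mult f1 mult_left_le_one_le real_norm_def)
  qed
  have key: "s * (\<integral>\<omega>. f (?S \<omega>) * ?D \<omega> \<partial>P) \<le> 0" if s: "\<bar>s\<bar> = 1" for s :: real
  proof -
    let ?\<psi> = "\<lambda>y. 1 + s * f (\<Sum>i<n. y ! i)"
    have Y: "(\<Sum>i<n. map (\<lambda>k. \<xi> k \<omega>) [1..<Suc n] ! i) = ?S \<omega>" for \<omega>
      by (intro sum.cong) (auto simp del: upt_Suc)
    have "(\<integral>\<omega>. ?\<psi> (map (\<lambda>k. \<xi> k \<omega>) [1..<Suc n]) * ?D \<omega> \<partial>P) \<le> 0"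
    proof (rule supermartingale_inequality[OF P _ _ n])
      show "?\<psi> \<in> Cb_Lip n"
        by (intro Cb_Lip_add Cb_Lip_mult Cb_Lip_const Cb_Lip_sum_coordinates fbl)
      show "0 \<le> 1 + s * f (\<Sum>i<n. y ! i)" for y
        using f1[of "\<Sum>i<n. y ! i"] s by (auto simp: abs_if split: if_splits)
      show "(\<lambda>\<omega>. ?\<psi> (map (\<lambda>k. \<xi> k \<omega>) [1..<Suc n])) \<in> borel_measurable borel"
        unfolding Y using fS_meas by measurable
    qed
    then have "(\<integral>\<omega>. ?D \<omega> + s * (f (?S \<omega>) * ?D \<omega>) \<partial>P) \<le> 0"
      unfolding Y by (simp add: algebra_simps)
    then show ?thesis using D fD by simp
  qed
  show ?thesis using key[of 1] key[of "-1"] by simp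
qed

end

section \<open>The averages of kappa\<close>

lemma kappa_cases:
  assumes "1 \<le> n"
  shows "kappa lo hi \<mu> n = lo \<or> kappa lo hi \<mu> n = hi"
proof -
  obtain m where "n = Suc m" using assms by (cases n) auto
  then show ?thesis by (cases m) auto
qed

text \<open>
  The deviation \<open>D\<close> of the partial sum from \<open>n * \<mu>\<close> moves by \<open>hi - \<mu> \<ge> 0\<close> when \<open>D \<le> 0\<close> and by \<open>lo - \<mu> \<le> 0\<close> when
  \<open>D > 0\<close>. Each step goes towards 0 and is at most \<open>hi - lo\<close> long, so it never leaves \<open>[- (hi - lo), hi - lo]\<close>.
\<close>

lemma kappa_sum_error:
  assumes "lo \<le> \<mu>" "\<mu> \<le> hi"
  shows "\<bar>(\<Sum>k=1..n. kappa lo hi \<mu> k) - real n * \<mu>\<bar> \<le> hi - lo"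
proof (induction n)
  case 0
  show ?case using assms by simp
next
  case (Suc n)
  let ?S = "\<Sum>k=1..n. kappa lo hi \<mu> k"
  have sum: "(\<Sum>k=1..Suc n. kappa lo hi \<mu> k) - real (Suc n) * \<mu> = (?S - real n * \<mu>) + (kappa lo hi \<mu> (Suc n) - \<mu>)"
    by (simp add: algebra_simps)
  show ?case
  proof (cases n)
    \<comment> \<open>At the first step either value is within \<open>hi - lo\<close> of \<open>\<mu>\<close>, whatever the choice.\<close>
    case 0
    then show ?thesis using assms by auto
  next
    case (Suc m)
    then have n: "0 < real n" and kap: "kappa lo hi \<mu> (Suc n) = (if ?S / real n \<le> \<mu> then hi else lo)"
      by simp_all
    have "?S / real n \<le> \<mu> \<longleftrightarrow> ?S - real n * \<mu> \<le> 0" using n by (simp add: field_simps)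
    then show ?thesis unfolding sum using kap Suc.IH assms by auto
  qed
qed

lemma kappa_average_tendsto:
  assumes "lo \<le> \<mu>" "\<mu> \<le> hi"
  shows "(\<lambda>n. (\<Sum>k=1..n. kappa lo hi \<mu> k) / real n) \<longlonglongrightarrow> \<mu>"
proof -
  have "(\<lambda>n. (hi - lo) / real n) \<longlonglongrightarrow> 0" by (rule lim_const_over_n)
  moreover have "\<forall>\<^sub>F n in sequentially. norm ((\<Sum>k=1..n. kappa lo hi \<mu> k) / real n - \<mu>) \<le> (hi - lo) / real n"
    using eventually_gt_at_top[of 0]
  proof eventually_elim
    case (elim n)
    have "(\<Sum>k=1..n. kappa lo hi \<mu> k) / real n - \<mu> = ((\<Sum>k=1..n. kappa lo hi \<mu> k) - real n * \<mu>) / real n"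
      using elim by (simp add: field_simps)
    then show ?case using kappa_sum_error[OF assms, of n] elim by (simp add: abs_divide divide_right_mono)
  qed
  ultimately have "(\<lambda>n. (\<Sum>k=1..n. kappa lo hi \<mu> k) / real n - \<mu>) \<longlonglongrightarrow> 0"
    by (rule Lim_null_comparison[rotated])
  then show ?thesis by (rule LIM_zero_cancel)
qed

section \<open>Weak continuity of expectations\<close>

lemma L_space_borel: "X \<in> L_space \<Theta> q \<Longrightarrow> X \<in> borel_measurable borel"
  unfolding L_space_def by simp

lemma bcontfun_borel: "(f :: 'a::polish_space \<Rightarrow> real) \<in> bcontfun \<Longrightarrow> f \<in> borel_measurable borel"
  by (intro borel_measurable_continuous_onI) (simp add: bcontfun_def)

lemma L_space_approx_powr:
  assumes "X \<in> L_space \<Theta> q" "0 < e"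
  obtains f where "f \<in> bcontfun" "\<And>P. P \<in> \<Theta> \<Longrightarrow> (\<integral>\<^sup>+\<omega>. ennreal (\<bar>X \<omega> - f \<omega>\<bar> powr q) \<partial>P) \<le> ennreal e"
proof -
  obtain F where F: "\<And>n::nat. F n \<in> bcontfun"
    "(\<lambda>n. SUP P\<in>\<Theta>. \<integral>\<^sup>+\<omega>. ennreal (\<bar>X \<omega> - F n \<omega>\<bar> powr q) \<partial>P) \<longlonglongrightarrow> 0"
    using assms(1) unfolding L_space_def by blast
  have "\<forall>\<^sub>F n in sequentially. (SUP P\<in>\<Theta>. \<integral>\<^sup>+\<omega>. ennreal (\<bar>X \<omega> - F n \<omega>\<bar> powr q) \<partial>P) < ennreal e"
    using F(2) assms(2) by (intro order_tendstoD) auto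
  then obtain n where n: "(SUP P\<in>\<Theta>. \<integral>\<^sup>+\<omega>. ennreal (\<bar>X \<omega> - F n \<omega>\<bar> powr q) \<partial>P) < ennreal e"
    using eventually_happens' sequentially_bot by blast
  show thesis
  proof (rule that[OF F(1)])
    fix P assume "P \<in> \<Theta>"
    then show "(\<integral>\<^sup>+\<omega>. ennreal (\<bar>X \<omega> - F n \<omega>\<bar> powr q) \<partial>P) \<le> ennreal e"
      using n by (meson SUP_upper less_imp_le order_trans)
  qed
qed

lemma L_space_moment_bound:
  assumes X: "X \<in> L_space \<Theta> q" and pq: "0 \<le> p" "p \<le> q"
    and prob: "\<Theta> \<subseteq> space (prob_algebra borel)"
  obtains K where "0 \<le> K" "\<And>P. P \<in> \<Theta> \<Longrightarrow> (\<integral>\<^sup>+\<omega>. ennreal (\<bar>X \<omega>\<bar> powr p) \<partial>P) \<le> ennreal K"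
proof -
  obtain f where f: "f \<in> bcontfun" "\<And>P. P \<in> \<Theta> \<Longrightarrow> (\<integral>\<^sup>+\<omega>. ennreal (\<bar>X \<omega> - f \<omega>\<bar> powr q) \<partial>P) \<le> ennreal 1"
    using L_space_approx_powr[OF X zero_less_one] by blast
  obtain b where b: "\<And>\<omega>. \<bar>f \<omega>\<bar> \<le> b"
    using f(1) unfolding bcontfun_def bounded_iff by auto
  define K where "K = (1 + 2 powr q * b powr q) + 2 powr q"
  have pointwise: "\<bar>X \<omega>\<bar> powr p \<le> (1 + 2 powr q * b powr q) + 2 powr q * \<bar>X \<omega> - f \<omega>\<bar> powr q" for \<omega>
  proof -
    let ?x = "\<bar>X \<omega> - f \<omega>\<bar>"
    have "\<bar>X \<omega>\<bar> powr p \<le> 1 + \<bar>X \<omega>\<bar> powr q"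
    proof (cases "\<bar>X \<omega>\<bar> \<le> 1")
      case True
      then have "\<bar>X \<omega>\<bar> powr p \<le> 1" using pq by (intro powr_le1) auto
      then show ?thesis by (smt (verit) powr_ge_zero)
    next
      case False
      then have "\<bar>X \<omega>\<bar> powr p \<le> \<bar>X \<omega>\<bar> powr q" using pq by (intro powr_mono) auto
      then show ?thesis by simp
    qed
    also have "\<bar>X \<omega>\<bar> powr q \<le> 2 powr q * (?x powr q + b powr q)"
      using b[of \<omega>] pq by (intro powr_le_of_le_add) auto
    finally show ?thesis by (simp add: algebra_simps)
  qed
  show thesis
  proof (rule that[of K])
    show "0 \<le> K" unfolding K_def by simp
    fix P assume P: "P \<in> \<Theta>"
    interpret prob_space P using P prob by (auto simp: space_prob_algebra)
    have sets: "sets P = sets borel" using P prob by (auto simp: space_prob_algebra)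
    have [measurable]: "X \<in> borel_measurable P" "f \<in> borel_measurable P"
      unfolding measurable_cong_sets[OF sets refl]
      by (fact L_space_borel[OF X], fact bcontfun_borel[OF f(1)])
    have "(\<integral>\<^sup>+\<omega>. ennreal (\<bar>X \<omega>\<bar> powr p) \<partial>P)
        \<le> (\<integral>\<^sup>+\<omega>. ennreal (1 + 2 powr q * b powr q) + ennreal (2 powr q) * ennreal (\<bar>X \<omega> - f \<omega>\<bar> powr q) \<partial>P)"
      using pointwise by (intro nn_integral_mono) (simp add: ennreal_leI flip: ennreal_mult ennreal_plus)
    also have "\<dots> = ennreal (1 + 2 powr q * b powr q) + ennreal (2 powr q) * (\<integral>\<^sup>+\<omega>. ennreal (\<bar>X \<omega> - f \<omega>\<bar> powr q) \<partial>P)"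
      by (simp add: nn_integral_add nn_integral_cmult emeasure_space_1 del: ennreal_plus)
    also have "\<dots> \<le> ennreal (1 + 2 powr q * b powr q) + ennreal (2 powr q) * ennreal 1"
      using f(2)[OF P] by (intro add_left_mono mult_left_mono) auto
    also have "\<dots> = ennreal K" unfolding K_def by (simp flip: ennreal_plus)
    finally show "(\<integral>\<^sup>+\<omega>. ennreal (\<bar>X \<omega>\<bar> powr p) \<partial>P) \<le> ennreal K" .
  qed
qed

lemma L_space_uniform_approx:
  assumes X: "X \<in> L_space \<Theta> q" and q: "1 < q" and e: "0 < e"
    and prob: "\<Theta> \<subseteq> space (prob_algebra borel)"
  obtains f where "f \<in> bcontfun" "\<And>P. P \<in> \<Theta> \<Longrightarrow> \<bar>(\<integral>\<omega>. f \<omega> \<partial>P) - (\<integral>\<omega>. X \<omega> \<partial>P)\<bar> \<le> e"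
proof -
  define \<theta> where "\<theta> = e / 2"
  have \<theta>: "0 < \<theta>" using e unfolding \<theta>_def by simp
  obtain f where f: "f \<in> bcontfun" "\<And>P. P \<in> \<Theta> \<Longrightarrow> (\<integral>\<^sup>+\<omega>. ennreal (\<bar>X \<omega> - f \<omega>\<bar> powr q) \<partial>P) \<le> ennreal (\<theta> powr q)"
    using L_space_approx_powr[OF X, of "\<theta> powr q"] \<theta> by auto
  show thesis
  proof (rule that[OF f(1)])
    fix P assume P: "P \<in> \<Theta>"
    interpret prob_space P using P prob by (auto simp: space_prob_algebra)
    have sets: "sets P = sets borel" using P prob by (auto simp: space_prob_algebra)
    have [measurable]: "X \<in> borel_measurable P" "f \<in> borel_measurable P"
      unfolding measurable_cong_sets[OF sets refl]
      by (fact L_space_borel[OF X], fact bcontfun_borel[OF f(1)])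
    obtain b where b: "\<And>\<omega>. \<bar>f \<omega>\<bar> \<le> b"
      using f(1) unfolding bcontfun_def bounded_iff by auto
    have fi: "integrable P f" using b by (intro integrable_const_bound[where B = b]) auto
    have di: "integrable P (\<lambda>\<omega>. \<bar>X \<omega> - f \<omega>\<bar> powr q)"
      using f(2)[OF P] by (intro integrableI_bounded) (auto intro: le_less_trans)
    have dq: "expectation (\<lambda>\<omega>. \<bar>X \<omega> - f \<omega>\<bar> powr q) \<le> \<theta> powr q"
      using f(2)[OF P] di by (subst (asm) nn_integral_eq_integral) auto
    have le: "\<bar>X \<omega> - f \<omega>\<bar> \<le> \<theta> + \<theta> powr (1 - q) * \<bar>X \<omega> - f \<omega>\<bar> powr q" for \<omega>
      using \<theta> q by (intro abs_le_weighted_powr) auto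
    have Xf: "integrable P (\<lambda>\<omega>. X \<omega> - f \<omega>)"
    proof (rule Bochner_Integration.integrable_bound)
      show "integrable P (\<lambda>\<omega>. \<theta> + \<theta> powr (1 - q) * \<bar>X \<omega> - f \<omega>\<bar> powr q)" using di by simp
      show "AE \<omega> in P. norm (X \<omega> - f \<omega>) \<le> norm (\<theta> + \<theta> powr (1 - q) * \<bar>X \<omega> - f \<omega>\<bar> powr q)"
        using le \<theta> by (intro AE_I2) (simp add: add_nonneg_nonneg)
    qed measurable
    then have Xi: "integrable P X" using Bochner_Integration.integrable_add[OF Xf fi] by simp
    have "\<bar>expectation f - expectation X\<bar> = \<bar>expectation (\<lambda>\<omega>. X \<omega> - f \<omega>)\<bar>"
      using fi Xi by simp
    also have "\<dots> \<le> expectation (\<lambda>\<omega>. \<bar>X \<omega> - f \<omega>\<bar>)" by (rule integral_abs_bound)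
    also have "\<dots> \<le> expectation (\<lambda>\<omega>. \<theta> + \<theta> powr (1 - q) * \<bar>X \<omega> - f \<omega>\<bar> powr q)"
      using Xf di le by (intro integral_mono) auto
    also have "\<dots> = \<theta> + \<theta> powr (1 - q) * expectation (\<lambda>\<omega>. \<bar>X \<omega> - f \<omega>\<bar> powr q)"
      using di by (simp add: prob_space)
    also have "\<dots> \<le> \<theta> + \<theta> powr (1 - q) * \<theta> powr q"
      using dq by (intro add_left_mono mult_left_mono) auto
    also have "\<dots> = e" using \<theta> by (simp add: \<theta>_def flip: powr_add)
    finally show "\<bar>(\<integral>\<omega>. f \<omega> \<partial>P) - (\<integral>\<omega>. X \<omega> \<partial>P)\<bar> \<le> e" .
  qed
qed

lemma topspace_weak_topology: "topspace weak_topology = space (prob_algebra (borel :: 'a::polish_space measure))"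
proof -
  have "(\<lambda>\<omega> :: 'a. 0 :: real) \<in> bcontfun" by (simp add: const_bcontfun)
  then have "space (prob_algebra borel) \<in> {{P \<in> space (prob_algebra borel). (\<integral>\<omega>. f \<omega> \<partial>P) \<in> U} | (f :: 'a \<Rightarrow> real) U.
        f \<in> bcontfun \<and> open U}"
    by (intro CollectI exI[of _ "\<lambda>\<omega>. 0"] exI[of _ UNIV]) simp
  then show ?thesis unfolding weak_topology_def topology_generated_by_topspace by (intro equalityI Union_upper) auto
qed

lemma continuous_map_integral_bcontfun:
  assumes "f \<in> bcontfun"
  shows "continuous_map weak_topology euclideanreal (\<lambda>P. \<integral>\<omega>. f \<omega> \<partial>P)"
  unfolding continuous_map
proof (intro conjI allI impI)
  fix U :: "real set" assume "openin euclidean U"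
  then show "openin weak_topology {P \<in> topspace weak_topology. (\<integral>\<omega>. f \<omega> \<partial>P) \<in> U}"
    unfolding topspace_weak_topology using assms unfolding weak_topology_def
    by (intro topology_generated_by_Basis CollectI exI[of _ f] exI[of _ U]) simp
qed simp

text \<open>
  On \<open>\<Theta>\<close> the map is a uniform limit of the continuous maps that belong to bounded continuous functions.
  On the whole space of probability measures it need not be continuous.
\<close>

lemma continuous_map_integral_L_space:
  assumes X: "X \<in> L_space \<Theta> q" and q: "1 < q" and prob: "\<Theta> \<subseteq> space (prob_algebra borel)"
  shows "continuous_map (subtopology weak_topology \<Theta>) euclideanreal (\<lambda>P. \<integral>\<omega>. X \<omega> \<partial>P)"
proof -
  have "\<exists>f. f \<in> bcontfun \<and> (\<forall>P\<in>\<Theta>. \<bar>(\<integral>\<omega>. f \<omega> \<partial>P) - (\<integral>\<omega>. X \<omega> \<partial>P)\<bar> \<le> 1 / real (Suc n))" for n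
    by (rule L_space_uniform_approx[OF X q _ prob, of "1 / real (Suc n)"]) (simp, blast)
  then obtain f where f: "\<And>n. f n \<in> bcontfun"
    "\<And>n P. P \<in> \<Theta> \<Longrightarrow> \<bar>(\<integral>\<omega>. f n \<omega> \<partial>P) - (\<integral>\<omega>. X \<omega> \<partial>P)\<bar> \<le> 1 / real (Suc n)"
    by metis
  have "continuous_map (subtopology weak_topology \<Theta>) Met_TC.mtopology (\<lambda>P. \<integral>\<omega>. X \<omega> \<partial>P)"
  proof (rule Met_TC.continuous_map_uniform_limit[where F = sequentially])
    show "\<forall>\<^sub>F n in sequentially. continuous_map (subtopology weak_topology \<Theta>) Met_TC.mtopology (\<lambda>P. \<integral>\<omega>. f n \<omega> \<partial>P)"
      using f(1) by (simp add: continuous_map_from_subtopology continuous_map_integral_bcontfun)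
    fix e :: real assume "0 < e"
    have "(\<lambda>n. 1 / real (Suc n)) \<longlonglongrightarrow> 0" by (rule LIMSEQ_Suc[OF lim_const_over_n])
    then have "\<forall>\<^sub>F n in sequentially. 1 / real (Suc n) < e" using \<open>0 < e\<close> by (rule order_tendstoD)
    then show "\<forall>\<^sub>F n in sequentially. \<forall>P\<in>topspace (subtopology weak_topology \<Theta>).
        (\<integral>\<omega>. X \<omega> \<partial>P) \<in> UNIV \<and> dist (\<integral>\<omega>. f n \<omega> \<partial>P) (\<integral>\<omega>. X \<omega> \<partial>P) < e"
      by eventually_elim (use f(2) in \<open>auto simp: dist_real_def intro: le_less_trans\<close>)
  qed auto
  then show ?thesis by simp
qed

section \<open>The optimal measure and its strong law\<close>

text \<open>
  The total defect \<open>gap n\<close> is a sum of nonnegative terms, so it grows with \<open>n\<close>, and the sets where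
  \<open>gap n \<le> 1 / n\<close> are nested. They are closed and nonempty; a measure in all of them has
  \<open>gap k \<le> 1 / n\<close> for all \<open>n \<ge> k\<close>, that is, no defect at all.
\<close>

lemma (in iid_sublinear) exists_optimal:
  assumes compact: "compactin weak_topology \<Theta>"
    and cont: "\<And>k. 1 \<le> k \<Longrightarrow> continuous_map (subtopology weak_topology \<Theta>) euclideanreal (\<lambda>P. \<integral>\<omega>. \<xi> k \<omega> \<partial>P)"
    and c: "\<And>i. \<bar>c i\<bar> \<le> 1"
  shows "\<exists>P\<in>\<Theta>. \<forall>k\<ge>1. (\<integral>\<omega>. c k * \<xi> k \<omega> \<partial>P) = upper (c k)"
proof -
  define gap where "gap n P = (\<Sum>i=1..n. upper (c i) - (\<integral>\<omega>. c i * \<xi> i \<omega> \<partial>P))" for n P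
  define C where "C n = {P \<in> \<Theta>. gap (Suc n) P \<le> 1 / real (Suc n)}" for n
  have top: "topspace (subtopology weak_topology \<Theta>) = \<Theta>"
    using compactin_subset_topspace[OF compact] by auto
  have gap_mono: "gap m P \<le> gap n P" if "m \<le> n" "P \<in> \<Theta>" for m n P
    unfolding gap_def using that integral_le_upper[OF that(2)]
    by (intro sum_mono2) auto
  have "(\<Inter>n. C n) \<noteq> {}"
  proof (rule compact_space_imp_nest)
    show "compact_space (subtopology weak_topology \<Theta>)"
      using compact by (simp add: compactin_subspace)
    show "C n \<noteq> {}" for n
      using exists_near_optimal[of "Suc n" "1 / real (Suc n)" c] c unfolding C_def gap_def by auto
    show "closedin (subtopology weak_topology \<Theta>) (C n)" for n
    proof -
      have "continuous_map (subtopology weak_topology \<Theta>) euclideanreal (gap (Suc n))"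
        unfolding gap_def integral_mult_right_zero
        by (intro continuous_intros continuous_map_real_mult_left cont) auto
      from closedin_continuous_map_preimage[OF this, of "{..1 / real (Suc n)}"] show ?thesis
        unfolding C_def top by simp
    qed
    show "decseq C"
    proof (rule decseq_SucI, rule subsetI)
      fix n P assume P: "P \<in> C (Suc n)"
      have "gap (Suc n) P \<le> gap (Suc (Suc n)) P" using P by (intro gap_mono) (auto simp: C_def)
      also have "\<dots> \<le> 1 / real (Suc (Suc n))" using P by (simp add: C_def)
      also have "\<dots> \<le> 1 / real (Suc n)" by (simp add: field_simps)
      finally show "P \<in> C n" using P by (simp add: C_def)
    qed
  qed
  then obtain P where PC: "\<And>n. P \<in> C n" by blast
  then have P: "P \<in> \<Theta>" unfolding C_def by simp
  have "(\<integral>\<omega>. c k * \<xi> k \<omega> \<partial>P) = upper (c k)" if k: "1 \<le> k" for k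
  proof -
    have "gap k P \<le> 0"
    proof (rule LIMSEQ_le_const)
      show "(\<lambda>n. 1 / real (Suc n)) \<longlonglongrightarrow> 0" by (rule LIMSEQ_Suc[OF lim_const_over_n])
      have "gap k P \<le> 1 / real (Suc n)" if "k \<le> n" for n
        using gap_mono[of k "Suc n" P] that P PC[of n] by (auto simp: C_def)
      then show "\<exists>N. \<forall>n\<ge>N. gap k P \<le> 1 / real (Suc n)" by blast
    qed
    moreover have "upper (c k) - (\<integral>\<omega>. c k * \<xi> k \<omega> \<partial>P) \<le> gap k P"
      unfolding gap_def
      by (rule member_le_sum[of k "{1..k}" "\<lambda>i. upper (c i) - (\<integral>\<omega>. c i * \<xi> i \<omega> \<partial>P)"])
        (use k integral_le_upper[OF P] in auto)
    ultimately show ?thesis using integral_le_upper[OF P k, of "c k"] by linarith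
  qed
  then show ?thesis using P by blast
qed

lemma (in iid_sublinear) optimal_slln:
  assumes P: "P \<in> \<Theta>" and c: "\<And>k. \<bar>c k\<bar> = 1"
    and opt: "\<And>k. 1 \<le> k \<Longrightarrow> (\<integral>\<omega>. c k * \<xi> k \<omega> \<partial>P) = upper (c k)"
    and a: "\<And>k. 1 \<le> k \<Longrightarrow> (\<integral>\<omega>. \<xi> k \<omega> \<partial>P) = a k" and a_bd: "\<And>k. \<bar>a k\<bar> \<le> A"
  shows "AE \<omega> in P. (\<lambda>n. (\<Sum>k=1..n. \<xi> k \<omega> - a k) / real n) \<longlonglongrightarrow> 0"
proof -
  interpret prob_space P using prob P .
  define d where "d i \<omega> = \<xi> (Suc i) \<omega> - a (Suc i)" for i \<omega>
  have [measurable]: "\<xi> (Suc i) \<in> borel_measurable P" for i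
    using meas[of "Suc i"] borel_measurable_eq[OF P] by simp
  have d_meas [measurable]: "d i \<in> borel_measurable P" for i unfolding d_def by measurable
  have "AE \<omega> in P. (\<lambda>n. (\<Sum>i<n. d i \<omega>) / real n) \<longlonglongrightarrow> 0"
  proof (rule martingale_difference_slln[OF p _ d_meas])
    show "0 \<le> 2 powr p * (A powr p + K)" using K by simp
    fix i
    have "\<bar>d i \<omega>\<bar> powr p \<le> 2 powr p * (A powr p + \<bar>\<xi> (Suc i) \<omega>\<bar> powr p)" for \<omega>
      unfolding d_def using a_bd[of "Suc i"] p by (intro powr_le_of_le_add) auto
    then have "(\<integral>\<^sup>+\<omega>. ennreal (\<bar>d i \<omega>\<bar> powr p) \<partial>P)
        \<le> (\<integral>\<^sup>+\<omega>. ennreal (2 powr p) * (ennreal (A powr p) + ennreal (\<bar>\<xi> (Suc i) \<omega>\<bar> powr p)) \<partial>P)"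
      by (intro nn_integral_mono) (simp add: ennreal_leI flip: ennreal_mult ennreal_plus)
    also have "\<dots> = ennreal (2 powr p) * (ennreal (A powr p) + (\<integral>\<^sup>+\<omega>. ennreal (\<bar>\<xi> (Suc i) \<omega>\<bar> powr p) \<partial>P))"
      by (simp add: nn_integral_add nn_integral_cmult emeasure_space_1 del: ennreal_plus)
    also have "\<dots> \<le> ennreal (2 powr p) * (ennreal (A powr p) + ennreal K)"
      using moment[OF P, of "Suc i"] by (intro mult_left_mono add_left_mono) simp_all
    also have "\<dots> = ennreal (2 powr p * (A powr p + K))"
      using K by (simp add: ennreal_mult)
    finally show "(\<integral>\<^sup>+\<omega>. ennreal (\<bar>d i \<omega>\<bar> powr p) \<partial>P) \<le> ennreal (2 powr p * (A powr p + K))" .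
  next
    fix n f L
    assume f: "\<And>t. \<bar>f t\<bar> \<le> (1::real)" "\<And>s t. \<bar>f s - f t\<bar> \<le> L * \<bar>s - t\<bar>"
    show "expectation (\<lambda>\<omega>. f (\<Sum>i<n. d i \<omega>) * d n \<omega>) = 0"
    proof (cases "n = 0")
      case True
      then show ?thesis
        using a[of 1] integrable_xi[OF P, of 1] by (simp add: d_def prob_space)
    next
      case False
      let ?c = "c (Suc n)" and ?g = "\<lambda>t. f (t - (\<Sum>i<n. a (Suc i)))"
      have "expectation (\<lambda>\<omega>. ?g (\<Sum>i<n. \<xi> (Suc i) \<omega>) * (?c * \<xi> (Suc n) \<omega> - upper ?c)) = 0"
      proof (rule martingale_difference[OF P _ opt])
        show "\<bar>?g s - ?g t\<bar> \<le> L * \<bar>s - t\<bar>" for s t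
          using f(2)[of "s - (\<Sum>i<n. a (Suc i))" "t - (\<Sum>i<n. a (Suc i))"] by simp
      qed (use False f in auto)
      moreover have "upper ?c = ?c * a (Suc n)"
        using opt[of "Suc n"] a[of "Suc n"] by simp
      ultimately have "expectation (\<lambda>\<omega>. ?c * (f (\<Sum>i<n. d i \<omega>) * d n \<omega>)) = 0"
        by (simp add: d_def sum_subtractf algebra_simps)
      then show ?thesis using c[of "Suc n"] by auto
    qed
  qed
  moreover have "(\<Sum>i<n. d i \<omega>) = (\<Sum>k=1..n. \<xi> k \<omega> - a k)" for n \<omega>
    unfolding d_def by (rule sum.reindex_bij_witness[of _ "\<lambda>i. i - 1" Suc]) auto
  ultimately show ?thesis by (simp only:)
qed

theorem theorem3p6:
  fixes \<Theta> :: "'a::polish_space measure set"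
    and \<xi> :: "nat \<Rightarrow> 'a \<Rightarrow> real"
    and \<beta> \<mu> lo hi :: real
  assumes "\<Theta> \<noteq> {}"
    and "compactin weak_topology \<Theta>"
    and "\<beta> > 0"
    and "\<And>k. k \<ge> 1 \<Longrightarrow> \<xi> k \<in> L_space \<Theta> (1 + \<beta>)"
    and "iid_seq \<Theta> \<xi>"
    and "lo = - sublin_expectation \<Theta> (\<lambda>\<omega>. - \<xi> 1 \<omega>)"
    and "hi = sublin_expectation \<Theta> (\<xi> 1)"
    and "\<mu> \<in> {lo..hi}"
  shows "\<exists>P\<in>\<Theta>. (\<forall>n\<ge>1. (\<integral>\<omega>. \<xi> n \<omega> \<partial>P) = kappa lo hi \<mu> n) \<and>
           (AE \<omega> in P. (\<lambda>n. (\<Sum>k=1..n. \<xi> k \<omega>) / real n) \<longlonglongrightarrow> \<mu>)"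
proof -
  have prob: "\<Theta> \<subseteq> space (prob_algebra borel)"
    using compactin_subset_topspace[OF assms(2)] by (simp add: topspace_weak_topology)
  define p where "p = 1 + min \<beta> 1"
  have p: "1 < p" "p \<le> 2" "0 \<le> p" "p \<le> 1 + \<beta>" using assms(3) unfolding p_def by auto
  obtain K where K: "0 \<le> K" "\<And>P. P \<in> \<Theta> \<Longrightarrow> (\<integral>\<^sup>+\<omega>. ennreal (\<bar>\<xi> 1 \<omega>\<bar> powr p) \<partial>P) \<le> ennreal K"
    using L_space_moment_bound[OF assms(4)[OF order_refl] p(3,4) prob] by blast
  interpret model: iid_sublinear \<Theta> \<xi> p K
  proof
    show "P \<in> space (prob_algebra borel)" if "P \<in> \<Theta>" for P using prob that by blast
    show "\<xi> k \<in> borel_measurable borel" if "1 \<le> k" for k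
      using assms(4)[OF that] by (rule L_space_borel)
  qed (fact assms(1) assms(5) p K)+
  \<comment> \<open>The sign selects the upper or the lower mean; if \<open>lo = hi\<close>, either sign would be correct.\<close>
  define c where "c k = (if kappa lo hi \<mu> k = hi then 1 else - 1 :: real)" for k
  have abs_c: "\<bar>c k\<bar> = 1" for k unfolding c_def by simp
  have upper_c: "model.upper (c k) = c k * kappa lo hi \<mu> k" if "1 \<le> k" for k
    using kappa_cases[OF that, of lo hi \<mu>] assms(6,7) unfolding c_def model.upper_def by auto
  have cont: "continuous_map (subtopology weak_topology \<Theta>) euclideanreal (\<lambda>P. \<integral>\<omega>. \<xi> k \<omega> \<partial>P)" if "1 \<le> k" for k
    using continuous_map_integral_L_space[OF assms(4)[OF that] _ prob] assms(3) by simp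
  obtain P where P: "P \<in> \<Theta>" and opt: "\<And>k. 1 \<le> k \<Longrightarrow> (\<integral>\<omega>. c k * \<xi> k \<omega> \<partial>P) = model.upper (c k)"
    using model.exists_optimal[OF assms(2) cont, of c] abs_c by (metis order_refl)
  have mean: "(\<integral>\<omega>. \<xi> k \<omega> \<partial>P) = kappa lo hi \<mu> k" if "1 \<le> k" for k
    using opt[OF that] upper_c[OF that] unfolding c_def by (auto split: if_splits)
  have "\<bar>kappa lo hi \<mu> k\<bar> \<le> \<bar>lo\<bar> + \<bar>hi\<bar>" for k
    using kappa_cases[of k lo hi \<mu>] by (cases "k = 0") auto
  then have dev: "AE \<omega> in P. (\<lambda>n. (\<Sum>k=1..n. \<xi> k \<omega> - kappa lo hi \<mu> k) / real n) \<longlonglongrightarrow> 0"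
    using model.optimal_slln[OF P abs_c opt mean] by blast
  have "(\<lambda>n. (\<Sum>k=1..n. kappa lo hi \<mu> k) / real n) \<longlonglongrightarrow> \<mu>"
    using assms(8) by (intro kappa_average_tendsto) auto
  from dev have "AE \<omega> in P. (\<lambda>n. (\<Sum>k=1..n. \<xi> k \<omega>) / real n) \<longlonglongrightarrow> \<mu>"
  proof eventually_elim
    case (elim \<omega>)
    from tendsto_add[OF elim \<open>(\<lambda>n. (\<Sum>k=1..n. kappa lo hi \<mu> k) / real n) \<longlonglongrightarrow> \<mu>\<close>]
    show ?case by (simp add: sum_subtractf diff_divide_distrib)
  qed
  with P mean show ?thesis by blast
qed

end
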